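(* Let $0<q<1$ and let $\mathcal{C}_q$ be the Casimir element of the (extended) Hopf $*$-algebra $U_q(su(3))$ given by $$\mathcal{C}_q=(q-q^{-1})^{-2}\Big((H+H^{-1})\{(qK_1K_2)^2+(qK_1K_2)^{-2}\}+H^2+H^{-2}-6\Big)+(qHK_2^2+q^{-1}H^{-1}K_2^{-2})F_1E_1+(qH^{-1}K_1^2+q^{-1}HK_1^{-2})F_2E_2+qH[F_2,F_1]_q[E_1,E_2]_q+qH^{-1}[F_1,F_2]_q[E_2,E_1]_q .$$ Then $\mathcal{C}_q\triangleright a=\mathcal{C}_q\blacktriangleright a$ for all $a\in\mathcal{A}(SU_q(3))$.
   Context: Notation: $0<q<1$, $[a,b]_q=ab-q^{-1}ba$. $U_q(su(3))$ is the Hopf $*$-algebra generated by $K_i=K_i^*$, $K_i^{-1}$, $E_i$, $F_i=E_i^*$ ($i=1,2$) with relations $[K_1,K_2]=0$, $K_iE_iK_i^{-1}=qE_i$, $[E_i,F_i]=(q-q^{-1})^{-1}(K_i^2-K_i^{-2})$, and for $i\ne j$: $K_iE_jK_i^{-1}=q^{-1/2}E_j$, $[E_i,F_j]=0$, $E_i^2E_j-(q+q^{-1})E_iE_jE_i+E_jE_i^2=0$. Coproduct $\Delta(K_i)=K_i\otimes K_i$, $\Delta(E_i)=E_i\otimes K_i+K_i^{-1}\otimes E_i$ (hence $\Delta(F_i)=F_i\otimes K_i+K_i^{-1}\otimes F_i$), counit $\epsilon(K_i)=1$, $\epsilon(E_i)=0$, antipode $S(K_i)=K_i^{-1}$, $S(E_i)=-qE_i$.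 It is extended by adjoining $H=(K_1K_2^{-1})^{2/3}$ and $H^{-1}$: $H=H^*$ is group-like, commutes with the $K_i$, $HE_1H^{-1}=qE_1$, $HE_2H^{-1}=q^{-1}E_2$, $H^3=(K_1K_2^{-1})^2$; the extension is still denoted $U_q(su(3))$. $\vartheta$ is the linear antimultiplicative map of $U_q(su(3))$ with $\vartheta(K_i)=K_i$, $\vartheta(H)=H$, $\vartheta(E_i)=F_i$, $\vartheta(F_i)=E_i$. $\mathcal{A}(SU_q(3))$ is the Hopf $*$-algebra generated by $u^i_j$ ($i,j=1,2,3$) with relations $u^i_ku^j_k=qu^j_ku^i_k$, $u^k_iu^k_j=qu^k_ju^k_i$ for $i<j$; $[u^i_l,u^j_k]=0$, $[u^i_k,u^j_l]=(q-q^{-1})u^i_lu^j_k$ for $i<j$, $k<l$; $\sum_{\pi\in S_3}(-q)^{\ell(\pi)}u^1_{\pi(1)}u^2_{\pi(2)}u^3_{\pi(3)}=1$ ($\ell$ = length); $(u^i_j)^*=(-q)^{j-i}(u^{k_1}_{l_1}u^{k_2}_{l_2}-qu^{k_1}_{l_2}u^{k_2}_{l_1})$ with $\{k_1<k_2\}=\{1,2,3\}\setminus\{i\}$, $\{l_1<l_2\}=\{1,2,3\}\setminus\{j\}$; $\Delta(u^i_j)=\sum_ku^i_k\otimes u^k_j$, $\epsilon(u^i_j)=\delta^i_j$, $S(u^i_j)=(u^j_i)^*$. The non-degenerate dual pairing $\langle\,,\,\rangle:U_q(su(3))\times\mathcal{A}(SU_q(3))\to\mathbb{C}$ is determined by $\langle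 h,u^i_j\rangle=\sigma^i_j(h)$ (row $i$, column $j$), where $\sigma$ is the $*$-representation on $\mathbb{C}^3$ with $\sigma(K_1)=\mathrm{diag}(q^{-1/2},q^{1/2},1)$, $\sigma(K_2)=\mathrm{diag}(1,q^{-1/2},q^{1/2})$, $\sigma(H)=\mathrm{diag}(q^{-1/3},q^{2/3},q^{-1/3})$, $\sigma(E_1)$ = matrix unit with 1 in row 2, column 1, $\sigma(E_2)$ = matrix unit with 1 in row 3, column 2. The two left actions of $U_q(su(3))$ on $\mathcal{A}(SU_q(3))$ are (Sweedler notation) $h\triangleright a=a_{(1)}\langle h,a_{(2)}\rangle$ and $h\blacktriangleright a=a\triangleleft\vartheta(h)$, where $a\triangleleft h=\langle h,a_{(1)}\rangle a_{(2)}$. *)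

theory Defs
  imports "HOL-Analysis.Analysis" "HOL-Library.Poly_Mapping"
begin

hide_const (open) Poly_Mapping.range

section \<open>Complex algebras\<close>

class complex_vec = ab_group_add +
  fixes scaleC :: "complex \<Rightarrow> 'a \<Rightarrow> 'a" (infixr "*\<^sub>C" 75)
  assumes scaleC_add_right: "c *\<^sub>C (x + y) = c *\<^sub>C x + c *\<^sub>C y"
    and scaleC_add_left: "(c + d) *\<^sub>C x = c *\<^sub>C x + d *\<^sub>C x"
    and scaleC_scaleC: "c *\<^sub>C d *\<^sub>C x = (c * d) *\<^sub>C x"
    and scaleC_one: "1 *\<^sub>C x = x"

class complex_alg = complex_vec + ring +
  assumes mult_scaleC_left: "(c *\<^sub>C x) * y = c *\<^sub>C (x * y)"
    and mult_scaleC_right: "x * (c *\<^sub>C y) = c *\<^sub>C (x * y)"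

class complex_alg_1 = complex_alg + ring_1

instantiation complex :: complex_alg_1
begin
definition scaleC_complex :: "complex \<Rightarrow> complex \<Rightarrow> complex"
  where "scaleC_complex c x = c * x"
instance
  by standard (simp_all add: scaleC_complex_def algebra_simps)
end

definition clinear :: "('a::complex_vec \<Rightarrow> 'b::complex_vec) \<Rightarrow> bool" where
  "clinear f \<longleftrightarrow> (\<forall>x y. f (x + y) = f x + f y) \<and> (\<forall>c x. f (c *\<^sub>C x) = c *\<^sub>C f x)"

definition cbilinear :: "('a::complex_vec \<Rightarrow> 'b::complex_vec \<Rightarrow> 'c::complex_vec) \<Rightarrow> bool" where
  "cbilinear f \<longleftrightarrow> (\<forall>y. clinear (\<lambda>x. f x y)) \<and> (\<forall>x. clinear (f x))"

lemma scaleC_zero_left [simp]: "0 *\<^sub>C (x::'a::complex_vec) = 0"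
  using scaleC_add_left[of 0 0 x] by simp

lemma scaleC_zero_right [simp]: "c *\<^sub>C (0::'a::complex_vec) = 0"
  using scaleC_add_right[of c 0 0] by simp

lemma scaleC_minus_left: "(- c) *\<^sub>C (x::'a::complex_vec) = - (c *\<^sub>C x)"
  using scaleC_add_left[of c "- c" x] by (simp add: eq_neg_iff_add_eq_0 add.commute)

lemma clinear_zero: "clinear f \<Longrightarrow> f 0 = 0"
  unfolding clinear_def by (metis add_cancel_right_left)


section \<open>The algebraic tensor product over the complex numbers\<close>

text \<open>The tensor product is the free vector space on the pairs, modulo the bilinearity relations.\<close>

inductive_set tensor_null :: "('a::complex_vec \<times> 'b::complex_vec \<Rightarrow>\<^sub>0 complex) set" where
  zero: "0 \<in> tensor_null"
| diff: "x \<in> tensor_null \<Longrightarrow> y \<in> tensor_null \<Longrightarrow> x - y \<in> tensor_null"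
| addl: "Poly_Mapping.single (a + a', b) c - Poly_Mapping.single (a, b) c
           - Poly_Mapping.single (a', b) c \<in> tensor_null"
| addr: "Poly_Mapping.single (a, b + b') c - Poly_Mapping.single (a, b) c
           - Poly_Mapping.single (a, b') c \<in> tensor_null"
| scll: "Poly_Mapping.single (s *\<^sub>C a, b) c - Poly_Mapping.single (a, b) (s * c) \<in> tensor_null"
| sclr: "Poly_Mapping.single (a, s *\<^sub>C b) c - Poly_Mapping.single (a, b) (s * c) \<in> tensor_null"

lemma tensor_null_minus: "x \<in> tensor_null \<Longrightarrow> - x \<in> tensor_null"
  using tensor_null.diff[OF tensor_null.zero] by force

lemma tensor_null_add: "x \<in> tensor_null \<Longrightarrow> y \<in> tensor_null \<Longrightarrow> x + y \<in> tensor_null"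
  using tensor_null.diff[OF _ tensor_null_minus] by force

quotient_type (overloaded) ('a, 'b) tensor =
  "('a::complex_vec \<times> 'b::complex_vec) \<Rightarrow>\<^sub>0 complex" / "\<lambda>x y. x - y \<in> tensor_null"
proof (rule equivpI)
  show "reflp (\<lambda>x y. x - y \<in> tensor_null)"
    by (simp add: reflp_def tensor_null.zero)
  show "symp (\<lambda>x y. x - y \<in> tensor_null)"
    by (metis (no_types, lifting) minus_diff_eq sympI tensor_null_minus)
  show "transp (\<lambda>x y. x - y \<in> tensor_null)"
    by (rule transpI) (metis (no_types, lifting) add.commute diff_add_cancel diff_add_eq tensor_null_add)
qed

definition pm_scale :: "complex \<Rightarrow> ('k \<Rightarrow>\<^sub>0 complex) \<Rightarrow> ('k \<Rightarrow>\<^sub>0 complex)"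
  where "pm_scale s = Poly_Mapping.map (\<lambda>c. s * c)"

lemma lookup_pm_scale [simp]: "Poly_Mapping.lookup (pm_scale s x) k = s * Poly_Mapping.lookup x k"
  by (simp add: pm_scale_def Poly_Mapping.map.rep_eq when_def)

lemma pm_scale_simps:
  "pm_scale s (x + y) = pm_scale s x + pm_scale s y"
  "pm_scale s (x - y) = pm_scale s x - pm_scale s y"
  "pm_scale (s + t) x = pm_scale s x + pm_scale t x"
  "pm_scale s (pm_scale t x) = pm_scale (s * t) x"
  "pm_scale 1 x = x"
  "pm_scale s 0 = 0"
  "pm_scale s (Poly_Mapping.single k c) = Poly_Mapping.single k (s * c)"
  by (rule poly_mapping_eqI; simp add: lookup_add lookup_minus lookup_single when_def algebra_simps)+

lemma tensor_null_scale: "x \<in> tensor_null \<Longrightarrow> pm_scale s x \<in> tensor_null"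
proof (induction rule: tensor_null.induct)
  case (scll s' a b c)
  show ?case
    using tensor_null.scll[of s' a b "s * c"] by (simp add: pm_scale_simps mult.left_commute)
next
  case (sclr a s' b c)
  show ?case
    using tensor_null.sclr[of a s' b "s * c"] by (simp add: pm_scale_simps mult.left_commute)
qed (auto simp: pm_scale_simps intro: tensor_null.intros)

instantiation tensor :: (complex_vec, complex_vec) complex_vec
begin
lift_definition zero_tensor :: "('a, 'b) tensor" is 0 .
lift_definition plus_tensor :: "('a, 'b) tensor \<Rightarrow> ('a, 'b) tensor \<Rightarrow> ('a, 'b) tensor" is "(+)"
  by (metis add_diff_add tensor_null_add)
lift_definition minus_tensor :: "('a, 'b) tensor \<Rightarrow> ('a, 'b) tensor \<Rightarrow> ('a, 'b) tensor" is "(-)"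
proof -
  fix x y z w :: "'a \<times> 'b \<Rightarrow>\<^sub>0 complex"
  assume "x - y \<in> tensor_null" "z - w \<in> tensor_null"
  then have "(x - y) - (z - w) \<in> tensor_null" by (rule tensor_null.diff)
  then show "x - z - (y - w) \<in> tensor_null" by (simp add: algebra_simps)
qed
lift_definition uminus_tensor :: "('a, 'b) tensor \<Rightarrow> ('a, 'b) tensor" is uminus
  by (metis minus_diff_eq minus_diff_minus tensor_null_minus)
lift_definition scaleC_tensor :: "complex \<Rightarrow> ('a, 'b) tensor \<Rightarrow> ('a, 'b) tensor" is pm_scale
  by (metis pm_scale_simps(2) tensor_null_scale)
instance
  by standard (transfer; simp add: algebra_simps pm_scale_simps tensor_null.zero)+
end

lift_definition tens :: "'a::complex_vec \<Rightarrow> 'b::complex_vec \<Rightarrow> ('a, 'b) tensor" (infixr "\<otimes>" 72)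
  is "\<lambda>a b. Poly_Mapping.single (a, b) 1" .

lemma tens_add_left: "(x + y) \<otimes> z = x \<otimes> z + y \<otimes> z"
  by transfer (metis diff_diff_eq tensor_null.addl)

lemma tens_add_right: "z \<otimes> (x + y) = z \<otimes> x + z \<otimes> y"
  by transfer (metis diff_diff_eq tensor_null.addr)

lemma tens_scaleC_left: "(c *\<^sub>C x) \<otimes> y = c *\<^sub>C (x \<otimes> y)"
  by transfer (simp only: pm_scale_simps tensor_null.scll)

lemma tens_scaleC_right: "y \<otimes> (c *\<^sub>C x) = c *\<^sub>C (y \<otimes> x)"
  by transfer (simp only: pm_scale_simps tensor_null.sclr)

text \<open>The linear map on the tensor product induced by a bilinear map \<open>f\<close> (universal property
  \<open>tensor_lift_tens\<close>, \<open>clinear_tensor_lift\<close> below). The value \<open>tensor_lift f t\<close> is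
  \<open>\<Sum> f x y\<close> whenever \<open>t = \<Sum> x \<otimes> y\<close>, so it serves as Sweedler notation; it is meaningful only
  for bilinear \<open>f\<close>.\<close>

definition pm_lift :: "('a \<Rightarrow> 'b \<Rightarrow> 'c::complex_vec) \<Rightarrow> ('a \<times> 'b \<Rightarrow>\<^sub>0 complex) \<Rightarrow> 'c" where
  "pm_lift f x = (\<Sum>k\<in>Poly_Mapping.keys x. Poly_Mapping.lookup x k *\<^sub>C f (fst k) (snd k))"

definition tensor_lift ::
  "('a::complex_vec \<Rightarrow> 'b::complex_vec \<Rightarrow> 'c::complex_vec) \<Rightarrow> ('a, 'b) tensor \<Rightarrow> 'c" where
  "tensor_lift f t = pm_lift f (rep_tensor t)"

lemma pm_lift_add: "pm_lift f (x + y) = pm_lift f x + pm_lift f y"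
  unfolding pm_lift_def
  by (rule setsum_keys_plus_distrib) (simp_all add: scaleC_add_left)

lemma pm_lift_diff: "pm_lift f (x - y) = pm_lift f x - pm_lift f y"
  using pm_lift_add[of f "x - y" y] by simp

lemma pm_lift_single: "pm_lift f (Poly_Mapping.single (a, b) c) = c *\<^sub>C f a b"
  by (simp add: pm_lift_def)

lemma scaleC_sum: "c *\<^sub>C (\<Sum>i\<in>I. f i) = (\<Sum>i\<in>I. c *\<^sub>C (f i :: 'a::complex_vec))"
  by (induction I rule: infinite_finite_induct) (simp_all add: scaleC_add_right)

lemma pm_lift_scale: "pm_lift f (pm_scale s x) = s *\<^sub>C pm_lift f x"
proof (cases "s = 0")
  case True
  then have "pm_scale s x = 0" by (intro poly_mapping_eqI) simp
  with True show ?thesis by (simp add: pm_lift_def)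
next
  case False
  then have "Poly_Mapping.keys (pm_scale s x) = Poly_Mapping.keys x"
    by (auto simp: in_keys_iff)
  then show ?thesis by (simp add: pm_lift_def scaleC_sum scaleC_scaleC)
qed

lemma pm_lift_null:
  assumes "cbilinear f" "x \<in> tensor_null"
  shows "pm_lift f x = 0"
  using assms(2)
proof (induction rule: tensor_null.induct)
  case zero
  show ?case by (simp add: pm_lift_def)
qed (use assms(1) in \<open>simp_all add: pm_lift_diff pm_lift_single cbilinear_def clinear_def
       scaleC_add_right scaleC_scaleC mult.commute\<close>)

lemma tensor_lift_abs: "cbilinear f \<Longrightarrow> tensor_lift f (abs_tensor x) = pm_lift f x"
proof -
  assume f: "cbilinear f"
  have "rep_tensor (abs_tensor x) - x \<in> tensor_null"
    using Quotient3_tensor by (metis (no_types, lifting) Quotient3_def Quotient3_rep_abs tensor.abs_eq_iff)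
  then show ?thesis
    using pm_lift_null[OF f] by (force simp: tensor_lift_def pm_lift_diff)
qed

lemma tensor_lift_tens: "cbilinear f \<Longrightarrow> tensor_lift f (a \<otimes> b) = f a b"
  by (simp add: tens.abs_eq tensor_lift_abs pm_lift_single scaleC_one)

lemma clinear_tensor_lift: "cbilinear f \<Longrightarrow> clinear (tensor_lift f)"
  unfolding clinear_def
proof (intro conjI allI)
  assume f: "cbilinear f"
  show "tensor_lift f (x + y) = tensor_lift f x + tensor_lift f y" for x y
    by (induction x, induction y) (simp add: plus_tensor.abs_eq tensor_lift_abs[OF f] pm_lift_add)
  show "tensor_lift f (c *\<^sub>C x) = c *\<^sub>C tensor_lift f x" for c x
    by (induction x) (simp add: scaleC_tensor.abs_eq tensor_lift_abs[OF f] pm_lift_scale)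
qed

lemma pm_sum_single:
  "(\<Sum>k\<in>Poly_Mapping.keys x. Poly_Mapping.single k (Poly_Mapping.lookup x k)) = x"
  by (rule poly_mapping_eqI) (simp add: lookup_sum lookup_single when_def in_keys_iff)

lemma tensor_induct [case_names tens add]:
  assumes tens: "\<And>a b. P (a \<otimes> b)" and add: "\<And>x y. P x \<Longrightarrow> P y \<Longrightarrow> P (x + y)"
  shows "P (t :: ('a::complex_vec, 'b::complex_vec) tensor)"
proof -
  obtain x where t: "t = abs_tensor x"
    using Quotient3_abs_rep[OF Quotient3_tensor, of t] by metis
  have sgl: "P (abs_tensor (Poly_Mapping.single k c))" for k c
  proof -
    obtain a b where k: "k = (a, b)" by (cases k)
    have "abs_tensor (Poly_Mapping.single k c) = c *\<^sub>C (a \<otimes> b)"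
      by (simp add: tens.abs_eq scaleC_tensor.abs_eq pm_scale_simps k)
    also have "\<dots> = (c *\<^sub>C a) \<otimes> b"
      by (rule tens_scaleC_left[symmetric])
    finally show ?thesis using tens by simp
  qed
  have P0: "P (abs_tensor 0)"
    using sgl[of "(0, 0)" 0] by simp
  have "P (abs_tensor (\<Sum>k\<in>K. Poly_Mapping.single k (Poly_Mapping.lookup x k)))" if "finite K" for K
    using that
  proof (induction K)
    case empty
    show ?case using P0 by simp
  next
    case (insert k K)
    then show ?case
      using add[OF sgl insert.IH] by (simp add: plus_tensor.abs_eq)
  qed
  from this[of "Poly_Mapping.keys x"] show ?thesis
    by (simp add: pm_sum_single t)
qed

instantiation tensor :: (complex_alg, complex_alg) complex_alg
begin

definition times_tensor :: "('a, 'b) tensor \<Rightarrow> ('a, 'b) tensor \<Rightarrow> ('a, 'b) tensor" where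
  "x * y = tensor_lift (\<lambda>a b. tensor_lift (\<lambda>c d. (a * c) \<otimes> (b * d)) y) x"

lemma times_tensor_inner: "cbilinear (\<lambda>c d. ((a::'a) * c) \<otimes> ((b::'b) * d))"
  by (simp add: cbilinear_def clinear_def distrib_left tens_add_left tens_add_right
      mult_scaleC_right tens_scaleC_left tens_scaleC_right)

lemma times_tensor_outer:
  "cbilinear (\<lambda>a b. tensor_lift (\<lambda>c d. ((a::'a) * c) \<otimes> ((b::'b) * d)) y)"
proof -
  define T where "T a b = tensor_lift (\<lambda>c d. ((a::'a) * c) \<otimes> ((b::'b) * d))" for a b
  have lin: "T a b (u + v) = T a b u + T a b v" for a b u v
    using clinear_tensor_lift[OF times_tensor_inner] by (simp add: clinear_def T_def)
  have pure: "T a b (c \<otimes> d) = (a * c) \<otimes> (b * d)" for a b c d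
    unfolding T_def by (rule tensor_lift_tens[OF times_tensor_inner])
  have "T (a + a') b y = T a b y + T a' b y" for a a' b
    by (induction y rule: tensor_induct) (simp_all add: lin pure distrib_right tens_add_left ac_simps)
  moreover have "T a (b + b') y = T a b y + T a b' y" for a b b'
    by (induction y rule: tensor_induct) (simp_all add: lin pure distrib_right tens_add_right ac_simps)
  moreover have "T (s *\<^sub>C a) b y = s *\<^sub>C T a b y" for s a b
    by (induction y rule: tensor_induct)
      (simp_all add: lin pure mult_scaleC_left tens_scaleC_left scaleC_add_right)
  moreover have "T a (s *\<^sub>C b) y = s *\<^sub>C T a b y" for s a b
    by (induction y rule: tensor_induct)
      (simp_all add: lin pure mult_scaleC_left tens_scaleC_right scaleC_add_right)
  ultimately show ?thesis
    unfolding T_def[symmetric] by (simp add: cbilinear_def clinear_def)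
qed

lemma tens_times: "(a \<otimes> b) * y = tensor_lift (\<lambda>c d. ((a::'a) * c) \<otimes> ((b::'b) * d)) y"
  unfolding times_tensor_def by (rule tensor_lift_tens[OF times_tensor_outer])

lemma times_tensor_add:
  "(x + y) * z = x * z + y * (z :: ('a, 'b) tensor)"
  "z * (x + y) = z * x + z * (y :: ('a, 'b) tensor)"
proof -
  show l: "(x + y) * z = x * z + y * z" for x y z :: "('a, 'b) tensor"
    using clinear_tensor_lift[OF times_tensor_outer] by (simp add: times_tensor_def clinear_def)
  show "z * (x + y) = z * x + z * y"
  proof (induction z rule: tensor_induct)
    case (tens a b)
    show ?case
      using clinear_tensor_lift[OF times_tensor_inner]
      by (simp add: tens_times clinear_def)
  qed (simp add: l ac_simps)
qed

lemma times_tensor_tens: "(a \<otimes> b) * (c \<otimes> d) = ((a::'a) * c) \<otimes> ((b::'b) * d)"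
  unfolding tens_times by (rule tensor_lift_tens[OF times_tensor_inner])

instance
proof
  fix x y z :: "('a, 'b) tensor" and c :: complex
  have l: "(x \<otimes> x') * (y \<otimes> y') * t = (x \<otimes> x') * ((y \<otimes> y') * t)" for x y x' y' and t :: "('a, 'b) tensor"
    by (induction t rule: tensor_induct) (simp_all add: times_tensor_add times_tensor_tens mult.assoc)
  have l2: "(x \<otimes> x') * s * t = (x \<otimes> x') * (s * t)" for x x' and s t :: "('a, 'b) tensor"
    by (induction s rule: tensor_induct) (simp_all add: times_tensor_add l)
  show "x * y * z = x * (y * z)"
    by (induction x rule: tensor_induct) (simp_all add: times_tensor_add l2)
  show "(x + y) * z = x * z + y * z" "x * (y + z) = x * y + x * z"
    by (fact times_tensor_add)+
  show "c *\<^sub>C x * y = c *\<^sub>C (x * y)"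
    using clinear_tensor_lift[OF times_tensor_outer] by (simp add: times_tensor_def clinear_def)
  show "x * c *\<^sub>C y = c *\<^sub>C (x * y)"
  proof (induction x rule: tensor_induct)
    case (tens a b)
    show ?case
      using clinear_tensor_lift[OF times_tensor_inner]
      by (simp add: tens_times clinear_def)
  qed (simp add: times_tensor_add scaleC_add_right)
qed

end


section \<open>Hopf \<open>*\<close>-algebras and their dual pairings\<close>

record (overloaded) ('a::complex_alg_1) hopf_star =
  comult :: "'a \<Rightarrow> ('a, 'a) tensor"
  counit :: "'a \<Rightarrow> complex"
  antipode :: "'a \<Rightarrow> 'a"
  star :: "'a \<Rightarrow> 'a"

text \<open>Coassociativity is stated in \<open>A \<otimes> (A \<otimes> A)\<close>. As the involution is antilinear,
  \<open>\<Delta>(a\<^sup>*) = a\<^sub>1\<^sup>* \<otimes> a\<^sub>2\<^sup>*\<close> is expressed through arbitrary expansions of \<open>\<Delta>(a)\<close> into elementary tensors.\<close>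

definition hopf_star_algebra :: "('a::complex_alg_1) hopf_star \<Rightarrow> bool" where
  "hopf_star_algebra A \<longleftrightarrow>
     clinear (comult A) \<and> comult A 1 = 1 \<otimes> 1 \<and>
     (\<forall>a b. comult A (a * b) = comult A a * comult A b) \<and>
     clinear (counit A) \<and> counit A 1 = 1 \<and>
     (\<forall>a b. counit A (a * b) = counit A a * counit A b) \<and>
     (\<forall>a. tensor_lift (\<lambda>x y. tensor_lift (\<lambda>x' x''. x' \<otimes> (x'' \<otimes> y)) (comult A x)) (comult A a)
        = tensor_lift (\<lambda>x y. x \<otimes> comult A y) (comult A a)) \<and>
     (\<forall>a. tensor_lift (\<lambda>x y. counit A x *\<^sub>C y) (comult A a) = a) \<and>
     (\<forall>a. tensor_lift (\<lambda>x y. counit A y *\<^sub>C x) (comult A a) = a) \<and>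
     clinear (antipode A) \<and>
     (\<forall>a. tensor_lift (\<lambda>x y. antipode A x * y) (comult A a) = counit A a *\<^sub>C 1) \<and>
     (\<forall>a. tensor_lift (\<lambda>x y. x * antipode A y) (comult A a) = counit A a *\<^sub>C 1) \<and>
     (\<forall>a b. star A (a + b) = star A a + star A b) \<and>
     (\<forall>c a. star A (c *\<^sub>C a) = cnj c *\<^sub>C star A a) \<and>
     (\<forall>a b. star A (a * b) = star A b * star A a) \<and>
     (\<forall>a. star A (star A a) = a) \<and>
     (\<forall>a xs. comult A a = (\<Sum>(x, y)\<leftarrow>xs. x \<otimes> y) \<longrightarrow>
        comult A (star A a) = (\<Sum>(x, y)\<leftarrow>xs. star A x \<otimes> star A y)) \<and>
     (\<forall>a. counit A (star A a) = cnj (counit A a))"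

definition dual_pairing ::
  "('u::complex_alg_1) hopf_star \<Rightarrow> ('a::complex_alg_1) hopf_star \<Rightarrow> ('u \<Rightarrow> 'a \<Rightarrow> complex) \<Rightarrow> bool" where
  "dual_pairing U A p \<longleftrightarrow>
     cbilinear p \<and>
     (\<forall>h a b. p h (a * b) = tensor_lift (\<lambda>x y. p x a * p y b) (comult U h)) \<and>
     (\<forall>h g a. p (h * g) a = tensor_lift (\<lambda>x y. p h x * p g y) (comult A a)) \<and>
     (\<forall>h. p h 1 = counit U h) \<and>
     (\<forall>a. p 1 a = counit A a) \<and>
     (\<forall>h a. p (antipode U h) a = p h (antipode A a)) \<and>
     (\<forall>h a. p (star U h) a = cnj (p h (star A (antipode A a)))) \<and>
     (\<forall>h a. p h (star A a) = cnj (p (star U (antipode U h)) a))"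

definition nondegenerate :: "('u::zero \<Rightarrow> 'a::zero \<Rightarrow> complex) \<Rightarrow> bool" where
  "nondegenerate p \<longleftrightarrow>
     (\<forall>h. (\<forall>a. p h a = 0) \<longrightarrow> h = 0) \<and> (\<forall>a. (\<forall>h. p h a = 0) \<longrightarrow> a = 0)"

text \<open>The actions \<open>h \<triangleright> a\<close>, \<open>a \<triangleleft> h\<close> and \<open>h \<triangleright>' a = a \<triangleleft> \<theta>(h)\<close>, in this order.\<close>

definition left_action ::
  "('a::complex_alg_1) hopf_star \<Rightarrow> ('u \<Rightarrow> 'a \<Rightarrow> complex) \<Rightarrow> 'u \<Rightarrow> 'a \<Rightarrow> 'a" where
  "left_action A p h a = tensor_lift (\<lambda>x y. p h y *\<^sub>C x) (comult A a)"

definition right_action ::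
  "('a::complex_alg_1) hopf_star \<Rightarrow> ('u \<Rightarrow> 'a \<Rightarrow> complex) \<Rightarrow> 'a \<Rightarrow> 'u \<Rightarrow> 'a" where
  "right_action A p a h = tensor_lift (\<lambda>x y. p h x *\<^sub>C y) (comult A a)"

definition left_action2 ::
  "('a::complex_alg_1) hopf_star \<Rightarrow> ('u \<Rightarrow> 'a \<Rightarrow> complex) \<Rightarrow> ('u \<Rightarrow> 'u) \<Rightarrow> 'u \<Rightarrow> 'a \<Rightarrow> 'a" where
  "left_action2 A p \<theta> h a = right_action A p a (\<theta> h)"


section \<open>Algebras given by generators and relations\<close>

text \<open>The free unital algebra on a type of generators is the monoid algebra of the free monoid.\<close>

datatype 'g fword = FWord (letters: "'g list")

instantiation fword :: (type) monoid_add
begin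
definition zero_fword :: "'a fword" where "0 = FWord []"
definition plus_fword :: "'a fword \<Rightarrow> 'a fword \<Rightarrow> 'a fword"
  where "v + w = FWord (letters v @ letters w)"
instance
  by standard (simp_all add: zero_fword_def plus_fword_def)
end

type_synonym 'g free_alg = "'g fword \<Rightarrow>\<^sub>0 complex"

definition gen :: "'g \<Rightarrow> 'g free_alg" where
  "gen g = Poly_Mapping.single (FWord [g]) 1"

definition cst :: "complex \<Rightarrow> 'g free_alg" where
  "cst c = Poly_Mapping.single 0 c"

definition evaluate :: "('g \<Rightarrow> 'a::complex_alg_1) \<Rightarrow> 'g free_alg \<Rightarrow> 'a" where
  "evaluate v x = (\<Sum>w\<in>Poly_Mapping.keys x. Poly_Mapping.lookup x w *\<^sub>C prod_list (map v (letters w)))"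

inductive_set two_sided_ideal :: "('r::ring_1) set \<Rightarrow> 'r set" for R where
  zero: "0 \<in> two_sided_ideal R"
| rel: "r \<in> R \<Longrightarrow> r \<in> two_sided_ideal R"
| diff: "x \<in> two_sided_ideal R \<Longrightarrow> y \<in> two_sided_ideal R \<Longrightarrow> x - y \<in> two_sided_ideal R"
| mult_left: "x \<in> two_sided_ideal R \<Longrightarrow> r * x \<in> two_sided_ideal R"
| mult_right: "x \<in> two_sided_ideal R \<Longrightarrow> x * r \<in> two_sided_ideal R"

text \<open>The algebra \<open>'a\<close> is, via \<open>v\<close>, the quotient of the free algebra by the ideal generated by \<open>R\<close>.\<close>

definition presented_by :: "('g \<Rightarrow> 'a::complex_alg_1) \<Rightarrow> 'g free_alg set \<Rightarrow> bool" where
  "presented_by v R \<longleftrightarrow> surj (evaluate v) \<and> {x. evaluate v x = 0} = two_sided_ideal R"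


section \<open>The quantum enveloping algebra\<close>

datatype ix2 = N1 | N2

text \<open>\<open>Ki i\<close> and \<open>Hi\<close> stand for the inverses of \<open>K i\<close> and \<open>H\<close>.\<close>

datatype ugen = K ix2 | Ki ix2 | E ix2 | F ix2 | H | Hi

text \<open>The \<open>K\<close>-\<open>F\<close>, \<open>H\<close>-\<open>F\<close> and \<open>F\<close>-Serre relations are the adjoints of those for \<open>E\<close>; they have to be
  listed because \<open>presented_by\<close> refers to plain algebras, not to \<open>*\<close>-algebras.\<close>

definition uq_relations :: "real \<Rightarrow> ugen free_alg set" where
  "uq_relations q =
     {gen (K i) * gen (Ki i) - 1 | i. True} \<union> {gen (Ki i) * gen (K i) - 1 | i. True} \<union>
     {gen (K N1) * gen (K N2) - gen (K N2) * gen (K N1)} \<union>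
     {gen (K i) * gen (E i) * gen (Ki i) - cst q * gen (E i) | i. True} \<union>
     {gen (K i) * gen (F i) * gen (Ki i) - cst (1 / q) * gen (F i) | i. True} \<union>
     {gen (E i) * gen (F i) - gen (F i) * gen (E i)
        - cst (1 / (q - 1 / q)) * (gen (K i) ^ 2 - gen (Ki i) ^ 2) | i. True} \<union>
     {gen (K i) * gen (E j) * gen (Ki i) - cst (q powr (- 1/2)) * gen (E j) | i j. i \<noteq> j} \<union>
     {gen (K i) * gen (F j) * gen (Ki i) - cst (q powr (1/2)) * gen (F j) | i j. i \<noteq> j} \<union>
     {gen (E i) * gen (F j) - gen (F j) * gen (E i) | i j. i \<noteq> j} \<union>
     {gen (E i) ^ 2 * gen (E j) - cst (q + 1 / q) * gen (E i) * gen (E j) * gen (E i)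
        + gen (E j) * gen (E i) ^ 2 | i j. i \<noteq> j} \<union>
     {gen (F i) ^ 2 * gen (F j) - cst (q + 1 / q) * gen (F i) * gen (F j) * gen (F i)
        + gen (F j) * gen (F i) ^ 2 | i j. i \<noteq> j} \<union>
     {gen H * gen Hi - 1, gen Hi * gen H - 1} \<union>
     {gen H * gen (K i) - gen (K i) * gen H | i. True} \<union>
     {gen H * gen (E N1) * gen Hi - cst q * gen (E N1),
      gen H * gen (E N2) * gen Hi - cst (1 / q) * gen (E N2),
      gen H * gen (F N1) * gen Hi - cst (1 / q) * gen (F N1),
      gen H * gen (F N2) * gen Hi - cst q * gen (F N2)} \<union>
     {gen H ^ 3 - (gen (K N1) * gen (Ki N2)) ^ 2}"

text \<open>The values of the Hopf structure on \<open>F i\<close> and on the inverses of \<open>K i\<close> and \<open>H\<close> follow from the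
  ones given and the Hopf \<open>*\<close>-algebra axioms.\<close>

definition is_uq_su3 :: "real \<Rightarrow> ('u::complex_alg_1) hopf_star \<Rightarrow> (ugen \<Rightarrow> 'u) \<Rightarrow> bool" where
  "is_uq_su3 q U g \<longleftrightarrow>
     presented_by g (uq_relations q) \<and> hopf_star_algebra U \<and>
     (\<forall>i. star U (g (K i)) = g (K i)) \<and> (\<forall>i. star U (g (E i)) = g (F i)) \<and>
     star U (g H) = g H \<and>
     (\<forall>i. comult U (g (K i)) = g (K i) \<otimes> g (K i)) \<and>
     (\<forall>i. comult U (g (E i)) = g (E i) \<otimes> g (K i) + g (Ki i) \<otimes> g (E i)) \<and>
     comult U (g H) = g H \<otimes> g H \<and>
     (\<forall>i. counit U (g (K i)) = 1) \<and> (\<forall>i. counit U (g (E i)) = 0) \<and> counit U (g H) = 1 \<and>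
     (\<forall>i. antipode U (g (K i)) = g (Ki i)) \<and>
     (\<forall>i. antipode U (g (E i)) = - (q *\<^sub>C g (E i)))"

definition is_theta :: "(ugen \<Rightarrow> 'u::complex_alg_1) \<Rightarrow> ('u \<Rightarrow> 'u) \<Rightarrow> bool" where
  "is_theta g \<theta> \<longleftrightarrow>
     clinear \<theta> \<and> (\<forall>x y. \<theta> (x * y) = \<theta> y * \<theta> x) \<and>
     (\<forall>i. \<theta> (g (K i)) = g (K i)) \<and> \<theta> (g H) = g H \<and>
     (\<forall>i. \<theta> (g (E i)) = g (F i)) \<and> (\<forall>i. \<theta> (g (F i)) = g (E i))"

definition qcomm :: "real \<Rightarrow> 'u::complex_alg_1 \<Rightarrow> 'u \<Rightarrow> 'u" where
  "qcomm q a b = a * b - (1 / q) *\<^sub>C (b * a)"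

text \<open>The constant \<open>6\<close> is six times the unit; \<open>(q K\<^sub>1 K\<^sub>2)\<^sup>-\<^sup>1\<close> is written out as \<open>q\<^sup>-\<^sup>1 K\<^sub>2\<^sup>-\<^sup>1 K\<^sub>1\<^sup>-\<^sup>1\<close>.\<close>

definition casimir :: "real \<Rightarrow> (ugen \<Rightarrow> 'u::complex_alg_1) \<Rightarrow> 'u" where
  "casimir q g =
     (1 / (q - 1 / q) ^ 2) *\<^sub>C
       ((g H + g Hi) * ((q *\<^sub>C (g (K N1) * g (K N2))) ^ 2
                          + ((1 / q) *\<^sub>C (g (Ki N2) * g (Ki N1))) ^ 2)
        + g H ^ 2 + g Hi ^ 2 - 6)
     + (q *\<^sub>C (g H * g (K N2) ^ 2) + (1 / q) *\<^sub>C (g Hi * g (Ki N2) ^ 2)) * g (F N1) * g (E N1)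
     + (q *\<^sub>C (g Hi * g (K N1) ^ 2) + (1 / q) *\<^sub>C (g H * g (Ki N1) ^ 2)) * g (F N2) * g (E N2)
     + q *\<^sub>C (g H * qcomm q (g (F N2)) (g (F N1)) * qcomm q (g (E N1)) (g (E N2)))
     + q *\<^sub>C (g Hi * qcomm q (g (F N1)) (g (F N2)) * qcomm q (g (E N2)) (g (E N1)))"


section \<open>The quantum function algebra\<close>

datatype ix3 = I1 | I2 | I3

lemma UNIV_ix3: "UNIV = {I1, I2, I3}"
  using ix3.exhaust by auto

instance ix3 :: finite
  by standard (simp add: UNIV_ix3)

fun num :: "ix3 \<Rightarrow> nat" where
  "num I1 = 1" | "num I2 = 2" | "num I3 = 3"

instantiation ix3 :: linorder
begin
definition less_eq_ix3 :: "ix3 \<Rightarrow> ix3 \<Rightarrow> bool" where "i \<le> j \<longleftrightarrow> num i \<le> num j"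
definition less_ix3 :: "ix3 \<Rightarrow> ix3 \<Rightarrow> bool" where "i < j \<longleftrightarrow> num i < num j"
instance
proof
  show "i \<le> j \<Longrightarrow> j \<le> i \<Longrightarrow> i = j" for i j :: ix3
    by (cases i; cases j) (simp_all add: less_eq_ix3_def)
qed (auto simp: less_eq_ix3_def less_ix3_def)
end

abbreviation ugenA :: "ix3 \<Rightarrow> ix3 \<Rightarrow> (ix3 \<times> ix3) free_alg" where
  "ugenA i j \<equiv> gen (i, j)"

definition perm_length :: "(ix3 \<Rightarrow> ix3) \<Rightarrow> nat" where
  "perm_length \<pi> = card {(i, j). i < j \<and> \<pi> j < \<pi> i}"

definition suq3_relations :: "real \<Rightarrow> (ix3 \<times> ix3) free_alg set" where
  "suq3_relations q =
     {ugenA i k * ugenA j k - cst q * ugenA j k * ugenA i k | i j k. i < j} \<union>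
     {ugenA k i * ugenA k j - cst q * ugenA k j * ugenA k i | i j k. i < j} \<union>
     {ugenA i l * ugenA j k - ugenA j k * ugenA i l | i j k l. i < j \<and> k < l} \<union>
     {ugenA i k * ugenA j l - ugenA j l * ugenA i k - cst (q - 1 / q) * ugenA i l * ugenA j k
        | i j k l. i < j \<and> k < l} \<union>
     {(\<Sum>\<pi> | bij \<pi>. cst ((- q) ^ perm_length \<pi>) * ugenA I1 (\<pi> I1) * ugenA I2 (\<pi> I2) * ugenA I3 (\<pi> I3))
        - 1}"

definition is_suq3 :: "real \<Rightarrow> ('a::complex_alg_1) hopf_star \<Rightarrow> (ix3 \<Rightarrow> ix3 \<Rightarrow> 'a) \<Rightarrow> bool" where
  "is_suq3 q A u \<longleftrightarrow>
     presented_by (\<lambda>(i, j). u i j) (suq3_relations q) \<and> hopf_star_algebra A \<and>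
     (\<forall>i j k1 k2 l1 l2. k1 < k2 \<and> {k1, k2} = - {i} \<and> l1 < l2 \<and> {l1, l2} = - {j} \<longrightarrow>
        star A (u i j) = ((- q) powi (int (num j) - int (num i))) *\<^sub>C
          (u k1 l1 * u k2 l2 - q *\<^sub>C (u k1 l2 * u k2 l1))) \<and>
     (\<forall>i j. comult A (u i j) = (\<Sum>k\<in>UNIV. u i k \<otimes> u k j)) \<and>
     (\<forall>i j. counit A (u i j) = (if i = j then 1 else 0)) \<and>
     (\<forall>i j. antipode A (u i j) = star A (u j i))"


section \<open>The fundamental representation\<close>

definition diag3 :: "complex \<Rightarrow> complex \<Rightarrow> complex \<Rightarrow> complex ^ ix3 ^ ix3" where
  "diag3 a b c = (\<chi> i j. if i = j then (case i of I1 \<Rightarrow> a | I2 \<Rightarrow> b | I3 \<Rightarrow> c) else 0)"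

definition matrix_unit :: "ix3 \<Rightarrow> ix3 \<Rightarrow> complex ^ ix3 ^ ix3" where
  "matrix_unit r s = (\<chi> i j. if i = r \<and> j = s then 1 else 0)"

text \<open>Here \<open>M $ i $ j\<close> is the entry in row \<open>i\<close> and column \<open>j\<close>.\<close>

definition is_fundamental_rep ::
  "real \<Rightarrow> ('u::complex_alg_1) hopf_star \<Rightarrow> (ugen \<Rightarrow> 'u) \<Rightarrow> ('u \<Rightarrow> complex ^ ix3 ^ ix3) \<Rightarrow> bool" where
  "is_fundamental_rep q U g \<sigma> \<longleftrightarrow>
     (\<forall>x y. \<sigma> (x + y) = \<sigma> x + \<sigma> y) \<and>
     (\<forall>c x. \<sigma> (c *\<^sub>C x) = (\<chi> i j. c * \<sigma> x $ i $ j)) \<and>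
     \<sigma> 1 = mat 1 \<and> (\<forall>x y. \<sigma> (x * y) = \<sigma> x ** \<sigma> y) \<and>
     (\<forall>x. \<sigma> (star U x) = (\<chi> i j. cnj (\<sigma> x $ j $ i))) \<and>
     \<sigma> (g (K N1)) = diag3 (q powr (- 1/2)) (q powr (1/2)) 1 \<and>
     \<sigma> (g (K N2)) = diag3 1 (q powr (- 1/2)) (q powr (1/2)) \<and>
     \<sigma> (g H) = diag3 (q powr (- 1/3)) (q powr (2/3)) (q powr (- 1/3)) \<and>
     \<sigma> (g (E N1)) = matrix_unit I2 I1 \<and>
     \<sigma> (g (E N2)) = matrix_unit I3 I2"

end

theory Submission
  imports Defs
begin

text \<open>By non-degeneracy it suffices to pair both sides with an arbitrary \<open>h\<close>. This turns the claim
  into \<open>h C = \<theta>(C) h\<close>, that is, \<open>\<theta>(C) = C\<close> and \<open>C\<close> is central. The first holds because \<open>\<theta>\<close>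
  exchanges \<open>[F\<^sub>2, F\<^sub>1]\<^sub>q\<close> and \<open>[E\<^sub>1, E\<^sub>2]\<^sub>q\<close>. For the second, \<open>C\<close> has weight \<open>0\<close>, so it commutes with
  the \<open>K\<^sub>i\<close> and \<open>H\<close>; the commutators of its five summands with \<open>E\<^sub>1\<close> cancel; the symmetry
  \<open>1 \<leftrightarrow> 2\<close>, \<open>H \<leftrightarrow> H\<^sup>-\<^sup>1\<close> gives \<open>E\<^sub>2\<close>, and \<open>\<theta>\<close> gives the \<open>F\<^sub>i\<close>.\<close>

section \<open>Complex algebras and their presentations\<close>

lemma scaleC_minus_right: "c *\<^sub>C (- x) = - (c *\<^sub>C (x::'a::complex_vec))"
  using scaleC_add_right[of c x "- x"] by (simp add: eq_neg_iff_add_eq_0 add.commute)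

lemma scaleC_diff_right: "c *\<^sub>C (x - y) = c *\<^sub>C x - c *\<^sub>C (y::'a::complex_vec)"
  using scaleC_add_right[of c x "- y"] by (simp add: scaleC_minus_right)

lemma scaleC_diff_left: "(c - d) *\<^sub>C x = c *\<^sub>C x - d *\<^sub>C (x::'a::complex_vec)"
  using scaleC_add_left[of c "- d" x] by (simp add: scaleC_minus_left)

lemmas scaleC_algebra = scaleC_add_right scaleC_diff_right scaleC_scaleC scaleC_one
  mult_scaleC_left mult_scaleC_right

lemma clinear_diff: "clinear f \<Longrightarrow> f (x - y) = f x - f y"
  unfolding clinear_def by (metis add_diff_cancel_right' diff_add_cancel)

lemma evaluate_add: "evaluate v (x + y) = evaluate v x + evaluate v y"
  unfolding evaluate_def
  by (rule setsum_keys_plus_distrib) (simp_all add: scaleC_add_left)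

lemma evaluate_diff: "evaluate v (x - y) = evaluate v x - evaluate v y"
  using evaluate_add[of v "x - y" y] by simp

lemma evaluate_zero: "evaluate v 0 = 0"
  by (simp add: evaluate_def)

lemma evaluate_sum: "evaluate v (sum f I) = (\<Sum>i\<in>I. evaluate v (f i))"
  by (induction I rule: infinite_finite_induct) (simp_all add: evaluate_add evaluate_zero)

lemma evaluate_single:
  "evaluate v (Poly_Mapping.single w c) = c *\<^sub>C prod_list (map v (letters w))"
  by (simp add: evaluate_def)

text \<open>Both factors are expanded by \<open>pm_sum_single\<close> into multiples of single
  words, on which multiplication is concatenation.\<close>

lemma evaluate_mult: "evaluate v (x * y) = evaluate v x * evaluate v y"
proof -
  let ?s = "\<lambda>x k. Poly_Mapping.single k (Poly_Mapping.lookup x k)"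
  have s: "evaluate v (?s x k * ?s y l) = evaluate v (?s x k) * evaluate v (?s y l)" for k l
    by (simp add: mult_single evaluate_single plus_fword_def scaleC_algebra mult.commute)
  have "evaluate v (sum (?s x) (Poly_Mapping.keys x) * sum (?s y) (Poly_Mapping.keys y))
      = evaluate v (sum (?s x) (Poly_Mapping.keys x)) * evaluate v (sum (?s y) (Poly_Mapping.keys y))"
    unfolding sum_product evaluate_sum s ..
  then show ?thesis by (simp only: pm_sum_single)
qed

lemma evaluate_cst: "evaluate v (cst c) = c *\<^sub>C 1"
  by (simp add: cst_def evaluate_single zero_fword_def)

lemma evaluate_one: "evaluate v 1 = 1"
  using evaluate_cst[of v 1] by (simp add: cst_def scaleC_one)

lemma evaluate_gen: "evaluate v (gen a) = v a"
  by (simp add: gen_def evaluate_single scaleC_one)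

lemma evaluate_power: "evaluate v (x ^ n) = evaluate v x ^ n"
  by (induction n) (simp_all add: evaluate_one evaluate_mult)

lemmas evaluate_hom = evaluate_add evaluate_diff evaluate_mult evaluate_power evaluate_one
  evaluate_gen evaluate_cst

lemma presented_by_relation:
  assumes "presented_by v R" and "r \<in> R"
  shows "evaluate v r = 0"
  using assms two_sided_ideal.rel[of r R] unfolding presented_by_def by blast

text \<open>Commutation with the generators passes to words and their linear combinations, and
  \<open>evaluate\<close> is surjective.\<close>

lemma presented_by_central:
  assumes "presented_by v R" and "\<And>a. z * v a = v a * z"
  shows "z * x = x * z"
proof -
  have "z * prod_list (map v ws) = prod_list (map v ws) * z" for ws
  proof (induction ws)
    case (Cons w ws)
    then show ?case
      by simp (metis assms(2) mult.assoc)
  qed simp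
  then have "z * evaluate v y = evaluate v y * z" for y
    by (simp add: evaluate_def sum_distrib_left sum_distrib_right scaleC_algebra)
  then show ?thesis
    using assms(1) unfolding presented_by_def surj_def by metis
qed


section \<open>Commutation up to a scalar\<close>

text \<open>The weight relation \<open>x y x^-1 = c y\<close> freed of the inverse, so that it can
  also be stated with \<open>x\<close> a raising element.\<close>

definition qcommute :: "complex \<Rightarrow> 'a::complex_alg_1 \<Rightarrow> 'a \<Rightarrow> bool" where
  "qcommute c x y \<longleftrightarrow> x * y = c *\<^sub>C (y * x)"

lemma qcommute_one_iff: "qcommute 1 x y \<longleftrightarrow> x * y = y * x"
  by (simp add: qcommute_def scaleC_one)

lemma qcommute_mult_right: "qcommute c x y \<Longrightarrow> qcommute d x z \<Longrightarrow> qcommute (c * d) x (y * z)"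
  unfolding qcommute_def by (metis mult.assoc mult_scaleC_left mult_scaleC_right scaleC_scaleC)

lemma qcommute_sym: "qcommute c x y \<Longrightarrow> c \<noteq> 0 \<Longrightarrow> qcommute (1 / c) y x"
  unfolding qcommute_def by (simp add: scaleC_scaleC scaleC_one)

lemma qcommute_mult_left: "qcommute c x z \<Longrightarrow> qcommute d y z \<Longrightarrow> qcommute (c * d) (x * y) z"
  unfolding qcommute_def
  by (simp add: mult.assoc mult_scaleC_right) (simp add: scaleC_algebra mult.commute[of c] flip: mult.assoc)

text \<open>Multiplying \<open>x * y = c *\<^sub>C (y * x)\<close> by \<open>x'\<close> on both
  sides moves the scalar to the other product.\<close>

lemma qcommute_inverse:
  assumes "qcommute c x y" and "c \<noteq> 0" and "x * x' = 1" and "x' * x = 1"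
  shows "qcommute (1 / c) x' y"
proof -
  have "c *\<^sub>C (x' * y) = x' * (c *\<^sub>C (y * x)) * x'"
    using assms(3) by (simp add: scaleC_algebra mult.assoc)
  also have "\<dots> = x' * (x * y) * x'"
    using assms(1) by (simp add: qcommute_def)
  also have "\<dots> = y * x'"
    using assms(4) by (simp flip: mult.assoc)
  finally have "(1 / c) *\<^sub>C (c *\<^sub>C (x' * y)) = (1 / c) *\<^sub>C (y * x')" by simp
  then show ?thesis
    using assms(2) by (simp add: qcommute_def scaleC_scaleC scaleC_one)
qed

lemma qcommute_conj:
  assumes "x * y * x' = c *\<^sub>C y" and "x' * x = 1"
  shows "qcommute c x y"
proof -
  have "x * y = x * y * x' * x"
    using assms(2) by (simp add: mult.assoc)
  then show ?thesis
    using assms(1) by (simp add: qcommute_def scaleC_algebra)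
qed

lemma qcommute_add: "qcommute c x y \<Longrightarrow> qcommute c x z \<Longrightarrow> qcommute c x (y + z)"
  by (simp add: qcommute_def distrib_left distrib_right scaleC_algebra)

lemma qcommute_diff: "qcommute c x y \<Longrightarrow> qcommute c x z \<Longrightarrow> qcommute c x (y - z)"
  by (simp add: qcommute_def left_diff_distrib right_diff_distrib scaleC_algebra)

lemma qcommute_scaleC: "qcommute c x y \<Longrightarrow> qcommute c x (d *\<^sub>C y)"
  by (simp add: qcommute_def scaleC_algebra mult.commute)

lemma qcommute_commutator:
  assumes "qcommute c x y"
  shows "y * x - x * y = (1 - c) *\<^sub>C (y * x)"
  using assms by (simp add: qcommute_def scaleC_diff_left scaleC_one)

text \<open>Both monomials of the q-commutator carry the scalar \<open>c * d\<close>.\<close>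

lemma qcommute_qcomm:
  assumes "qcommute c x y" and "qcommute d x z"
  shows "qcommute (c * d) x (qcomm q y z)"
  unfolding qcomm_def
  using qcommute_mult_right[OF assms] qcommute_mult_right[OF assms(2,1)]
  by (intro qcommute_diff qcommute_scaleC) (simp_all add: mult.commute)


section \<open>The Casimir element\<close>

text \<open>The element \<open>C\<^sub>q\<close> in terms of \<open>a\<^sub>i = K\<^sub>i\<^sup>2\<close>, \<open>b\<^sub>i = K\<^sub>i\<^sup>-\<^sup>2\<close>, which makes the symmetry
  \<open>1 \<leftrightarrow> 2\<close>, \<open>h \<leftrightarrow> h'\<close> available.\<close>

definition cas where
  "cas q h h' a1 b1 e1 f1 a2 b2 e2 f2 =
     (1 / (complex_of_real q - 1 / complex_of_real q) ^ 2) *\<^sub>C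
       ((h + h') * ((complex_of_real q ^ 2) *\<^sub>C (a1 * a2) + (1 / complex_of_real q ^ 2) *\<^sub>C (b1 * b2))
         + h ^ 2 + h' ^ 2 - 6)
     + (q *\<^sub>C (h * a2) + (1 / complex_of_real q) *\<^sub>C (h' * b2)) * f1 * e1
     + (q *\<^sub>C (h' * a1) + (1 / complex_of_real q) *\<^sub>C (h * b1)) * f2 * e2
     + q *\<^sub>C (h * qcomm q f2 f1 * qcomm q e1 e2)
     + q *\<^sub>C (h' * qcomm q f1 f2 * qcomm q e2 (e1 :: 'u::complex_alg_1))"

text \<open>The exchange permutes the summands of \<open>cas\<close>; inside products only
  \<open>a1 * a2\<close> and \<open>b1 * b2\<close> change their order.\<close>

lemma cas_swap:
  assumes "a1 * a2 = a2 * a1" and "b1 * b2 = b2 * b1"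
  shows "cas q h h' a1 b1 e1 f1 a2 b2 e2 f2 = cas q h' h a2 b2 e2 f2 a1 b1 e1 f1"
  using assms by (simp add: cas_def ac_simps)

section \<open>Elements acting on the generators by weights\<close>

definition weight_element where
  "weight_element e1 f1 e2 f2 w \<longleftrightarrow> (\<exists>c d. c \<noteq> 0 \<and> d \<noteq> 0 \<and> qcommute c w e1 \<and> qcommute (1 / c) w f1 \<and>
     qcommute d w e2 \<and> qcommute (1 / d) w f2)"

lemma weight_element_mult:
  assumes "weight_element e1 f1 e2 f2 v" and "weight_element e1 f1 e2 f2 w"
  shows "weight_element e1 f1 e2 f2 (v * w)"
proof -
  obtain c d where v: "c \<noteq> 0" "d \<noteq> 0" "qcommute c v e1" "qcommute (1 / c) v f1"
    "qcommute d v e2" "qcommute (1 / d) v f2"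
    using assms(1) unfolding weight_element_def by blast
  obtain c' d' where w: "c' \<noteq> 0" "d' \<noteq> 0" "qcommute c' w e1" "qcommute (1 / c') w f1"
    "qcommute d' w e2" "qcommute (1 / d') w f2"
    using assms(2) unfolding weight_element_def by blast
  show ?thesis
    unfolding weight_element_def
    using v(1,2) w(1,2) qcommute_mult_left[OF v(3) w(3)] qcommute_mult_left[OF v(4) w(4)]
      qcommute_mult_left[OF v(5) w(5)] qcommute_mult_left[OF v(6) w(6)]
    by (intro exI[of _ "c * c'"] exI[of _ "d * d'"]) simp
qed

lemma weight_element_inverse:
  assumes "weight_element e1 f1 e2 f2 w" and "w * w' = 1" and "w' * w = 1"
  shows "weight_element e1 f1 e2 f2 w'"
proof -
  obtain c d where w: "c \<noteq> 0" "d \<noteq> 0" "qcommute c w e1" "qcommute (1 / c) w f1"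
    "qcommute d w e2" "qcommute (1 / d) w f2"
    using assms(1) unfolding weight_element_def by blast
  show ?thesis
    unfolding weight_element_def
    using w(1,2) qcommute_inverse[OF w(3) _ assms(2,3)] qcommute_inverse[OF w(4) _ assms(2,3)]
      qcommute_inverse[OF w(5) _ assms(2,3)] qcommute_inverse[OF w(6) _ assms(2,3)]
    by (intro exI[of _ "1 / c"] exI[of _ "1 / d"]) simp
qed

text \<open>Every \<open>e\<close> occurs together with its own \<open>f\<close>, which carries the
  inverse scalar, so the total weight is zero.\<close>

lemma weight_element_commute:
  assumes "weight_element e1 f1 e2 f2 w"
  shows "qcommute 1 w (f1 * e1)" and "qcommute 1 w (f2 * e2)"
    and "qcommute 1 w (qcomm q f2 f1 * qcomm q e1 e2)"
    and "qcommute 1 w (qcomm q f1 f2 * qcomm q e2 e1)"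
proof -
  obtain c d where w: "c \<noteq> 0" "d \<noteq> 0" "qcommute c w e1" "qcommute (1 / c) w f1"
    "qcommute d w e2" "qcommute (1 / d) w f2"
    using assms(1) unfolding weight_element_def by blast
  show "qcommute 1 w (f1 * e1)" "qcommute 1 w (f2 * e2)"
    using w(1,2) qcommute_mult_right[OF w(4,3)] qcommute_mult_right[OF w(6,5)] by simp_all
  show "qcommute 1 w (qcomm q f2 f1 * qcomm q e1 e2)" "qcommute 1 w (qcomm q f1 f2 * qcomm q e2 e1)"
    using w(1,2) qcommute_mult_right[OF qcommute_qcomm[OF w(6,4)] qcommute_qcomm[OF w(3,5)]]
      qcommute_mult_right[OF qcommute_qcomm[OF w(4,6)] qcommute_qcomm[OF w(5,3)]] by simp_all
qed

lemma cas_commute_weight: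
  assumes "weight_element e1 f1 e2 f2 w"
    and "\<And>t. t \<in> {h, h', a1, b1, a2, b2} \<Longrightarrow> w * t = t * w"
  shows "w * cas q h h' a1 b1 e1 f1 a2 b2 e2 f2 = cas q h h' a1 b1 e1 f1 a2 b2 e2 f2 * w"
proof -
  have p: "qcommute 1 w (x * y)" if "qcommute 1 w x" "qcommute 1 w y" for x y
    using qcommute_mult_right[OF that] by simp
  have p6: "qcommute 1 w 6"
    by (simp add: qcommute_one_iff mult_of_nat_commute[of 6, simplified])
  have t: "qcommute 1 w h" "qcommute 1 w h'" "qcommute 1 w a1" "qcommute 1 w b1"
    "qcommute 1 w a2" "qcommute 1 w b2"
    using assms(2) by (simp_all add: qcommute_one_iff)
  have "qcommute 1 w (cas q h h' a1 b1 e1 f1 a2 b2 e2 f2)"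
    \<comment> \<open>Of the squares in \<open>cas\<close>, only those of \<open>h\<close> and
      \<open>h'\<close> are products in the algebra; the others are squares of scalars.\<close>
    unfolding cas_def mult.assoc power2_eq_square[of h] power2_eq_square[of h']
    by (intro qcommute_add qcommute_diff qcommute_scaleC weight_element_commute[OF assms(1)] p6 t
        p[of h] p[of h'] p[of a1] p[of b1] p[of "h + h'"] p[OF _ weight_element_commute(1)[OF assms(1)]]
        p[OF _ weight_element_commute(2)[OF assms(1)]])
  then show ?thesis by (simp add: qcommute_one_iff)
qed

section \<open>Invariance of the Casimir element under \<theta>\<close>

text \<open>Reversal maps \<open>f1 * e1\<close> to itself and exchanges the two factors of each
  product of q-commutators, so these parts are fixed. The Cartan factor ends up on the right and
  returns to the left because the part has weight zero.\<close>

lemma antihom_cas: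
  assumes lin: "clinear \<theta>" and one: "\<theta> 1 = 1" and anti: "\<And>x y. \<theta> (x * y) = \<theta> y * \<theta> x"
    and t: "\<And>t. t \<in> {h, h', a1, b1, a2, b2} \<Longrightarrow> \<theta> t = t"
    and e: "\<theta> e1 = f1" "\<theta> e2 = f2" "\<theta> f1 = e1" "\<theta> f2 = e2"
    and w: "\<And>t. t \<in> {h, h', a1, b1, a2, b2} \<Longrightarrow> weight_element e1 f1 e2 f2 t"
    and comm: "\<And>s t. s \<in> {h, h', a1, b1, a2, b2} \<Longrightarrow> t \<in> {h, h', a1, b1, a2, b2} \<Longrightarrow> s * t = t * s"
  shows "\<theta> (cas q h h' a1 b1 e1 f1 a2 b2 e2 f2) = cas q h h' a1 b1 e1 f1 a2 b2 e2 f2"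
proof -
  have add: "\<theta> (x + y) = \<theta> x + \<theta> y" and scale: "\<theta> (c *\<^sub>C x) = c *\<^sub>C \<theta> x" for x y c
    using lin by (simp_all add: clinear_def)
  note diff = clinear_diff[OF lin]
  have qc: "\<theta> (qcomm q x y) = qcomm q (\<theta> y) (\<theta> x)" for x y
    by (simp add: qcomm_def diff scale anti)
  \<comment> \<open>Additivity reaches the numeral \<open>6\<close> only once it is written as a sum
    of units.\<close>
  have "\<theta> (1 + 1 + 1 + 1 + 1 + 1) = 1 + 1 + 1 + 1 + 1 + 1"
    unfolding add one ..
  then have six: "\<theta> 6 = 6" by simp
  have fe: "f1 * (e1 * x) = x * f1 * e1" "f2 * (e2 * x) = x * f2 * e2"
    "qcomm q f2 f1 * (qcomm q e1 e2 * x) = x * qcomm q f2 f1 * qcomm q e1 e2"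
    "qcomm q f1 f2 * (qcomm q e2 e1 * x) = x * qcomm q f1 f2 * qcomm q e2 e1"
    if "weight_element e1 f1 e2 f2 x" for x
    using weight_element_commute[OF that] by (simp_all add: qcommute_one_iff mult.assoc)
  have cc: "h' * h = h * h'" "a1 * h = h * a1" "a1 * h' = h' * a1" "a2 * h = h * a2" "a2 * h' = h' * a2"
    "b1 * h = h * b1" "b1 * h' = h' * b1" "b2 * h = h * b2" "b2 * h' = h' * b2"
    "a2 * a1 = a1 * a2" "b2 * b1 = b1 * b2"
    by (rule comm; simp)+
  have ccl: "a1 * (h * x) = h * (a1 * x)" "a1 * (h' * x) = h' * (a1 * x)" "a2 * (h * x) = h * (a2 * x)"
    "a2 * (h' * x) = h' * (a2 * x)" "b1 * (h * x) = h * (b1 * x)" "b1 * (h' * x) = h' * (b1 * x)"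
    "b2 * (h * x) = h * (b2 * x)" "b2 * (h' * x) = h' * (b2 * x)" for x
    by (simp_all add: cc flip: mult.assoc)
  have T: "\<theta> h = h" "\<theta> h' = h'" "\<theta> a1 = a1" "\<theta> b1 = b1" "\<theta> a2 = a2" "\<theta> b2 = b2"
    by (rule t; simp)+
  have W: "weight_element e1 f1 e2 f2 h" "weight_element e1 f1 e2 f2 h'"
    "weight_element e1 f1 e2 f2 a1" "weight_element e1 f1 e2 f2 b1"
    "weight_element e1 f1 e2 f2 a2" "weight_element e1 f1 e2 f2 b2"
    by (rule w; simp)+
  \<comment> \<open>These are the six Cartan factors standing before a weight-zero part:
    \<open>h\<close>, \<open>h'\<close>, \<open>h * a2\<close>, \<open>h' * b2\<close>,
    \<open>h' * a1\<close>, \<open>h * b1\<close>.\<close>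
  note fe' = fe[OF W(1)] fe[OF W(2)] fe[OF weight_element_mult[OF W(1,5)]]
    fe[OF weight_element_mult[OF W(2,6)]] fe[OF weight_element_mult[OF W(2,3)]]
    fe[OF weight_element_mult[OF W(1,4)]]
  show ?thesis
    unfolding cas_def power2_eq_square[of h] power2_eq_square[of h'] add diff scale anti qc six T e cc
      distrib_left distrib_right mult_scaleC_left mult_scaleC_right fe'
    by (simp add: cc ccl mult.assoc)
qed

lemma qcommute_serre:
  fixes q :: real
  defines "z \<equiv> complex_of_real q"
  assumes "z \<noteq> 0"
    and "e1 ^ 2 * e2 - (z + 1 / z) *\<^sub>C (e1 * e2 * e1) + e2 * e1 ^ 2 = 0"
  shows "qcommute z e1 (qcomm q e1 e2)" and "qcommute (1 / z) e1 (qcomm q e2 e1)"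
proof -
  have s: "e1 ^ 2 * e2 + e2 * e1 ^ 2 = z *\<^sub>C (e1 * e2 * e1) + (1 / z) *\<^sub>C (e1 * e2 * e1)"
    using assms(3) by (simp add: scaleC_add_left algebra_simps)
  have "e1 * qcomm q e1 e2 - z *\<^sub>C (qcomm q e1 e2 * e1)
      = (e1 ^ 2 * e2 + e2 * e1 ^ 2) - (z *\<^sub>C (e1 * e2 * e1) + (1 / z) *\<^sub>C (e1 * e2 * e1))"
    using assms(2)
    by (simp add: qcomm_def z_def[symmetric] power2_eq_square left_diff_distrib right_diff_distrib scaleC_algebra mult.assoc)
  with s show "qcommute z e1 (qcomm q e1 e2)" by (simp add: qcommute_def)
  have "(1 / z) *\<^sub>C (qcomm q e2 e1 * e1) - e1 * qcomm q e2 e1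
      = (1 / z) *\<^sub>C ((e1 ^ 2 * e2 + e2 * e1 ^ 2) - (z *\<^sub>C (e1 * e2 * e1) + (1 / z) *\<^sub>C (e1 * e2 * e1)))"
    using assms(2)
    by (simp add: qcomm_def z_def[symmetric] power2_eq_square left_diff_distrib right_diff_distrib scaleC_algebra mult.assoc)
  with s show "qcommute (1 / z) e1 (qcomm q e2 e1)" by (simp add: qcommute_def)
qed

text \<open>As \<open>e1\<close> commutes with \<open>f2\<close>, only the commutator of
  \<open>f1\<close> and \<open>e1\<close> contributes. Moving \<open>a1\<close> and
  \<open>b1\<close> to the left of \<open>f2\<close> makes the \<open>a1\<close> terms cancel in the
  first identity and the \<open>b1\<close> terms in the second.\<close>

lemma commutator_qcomm:
  fixes q :: real
  defines "z \<equiv> complex_of_real q"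
  assumes "z \<noteq> 0" and "z - 1 / z \<noteq> 0"
    and "e1 * f1 - f1 * e1 = (1 / (z - 1 / z)) *\<^sub>C (a1 - b1)" and "e1 * f2 = f2 * e1"
    and "qcommute z a1 f2" and "qcommute (1 / z) b1 f2"
  shows "qcomm q f2 f1 * e1 - e1 * qcomm q f2 f1 = b1 * f2"
    and "qcomm q f1 f2 * e1 - e1 * qcomm q f1 f2 = (- (1 / z)) *\<^sub>C (a1 * f2)"
proof -
  define l where "l = 1 / (z - 1 / z)"
  have a: "f2 * a1 = (1 / z) *\<^sub>C (a1 * f2)"
    using qcommute_sym[OF assms(6,2)] by (simp add: qcommute_def)
  have b: "f2 * b1 = z *\<^sub>C (b1 * f2)"
    using qcommute_sym[OF assms(7)] assms(2) by (simp add: qcommute_def)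
  have c: "f1 * e1 - e1 * f1 = l *\<^sub>C (b1 - a1)"
    using arg_cong[OF assms(4), of uminus] by (simp add: scaleC_diff_right l_def)
  have f2: "f2 * e1 = e1 * f2" using assms(5) by simp
  have x: "x * f2 * e1 - e1 * x * f2 = (x * e1 - e1 * x) * f2" for x
    using f2 by (simp add: left_diff_distrib mult.assoc)
  have 1: "f2 * f1 * e1 - e1 * f2 * f1 = f2 * (f1 * e1 - e1 * f1)"
    using assms(5) by (simp add: right_diff_distrib) (metis mult.assoc)
  have 2: "f1 * f2 * e1 - e1 * f1 * f2 = (f1 * e1 - e1 * f1) * f2"
    by (rule x)
  have "qcomm q f2 f1 * e1 - e1 * qcomm q f2 f1
     = (f2 * f1 * e1 - e1 * f2 * f1) - (1 / z) *\<^sub>C (f1 * f2 * e1 - e1 * f1 * f2)"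
    by (simp add: qcomm_def z_def left_diff_distrib right_diff_distrib scaleC_algebra mult.assoc)
  also have "\<dots> = (l * z) *\<^sub>C (b1 * f2) - (l / z) *\<^sub>C (a1 * f2) - (l / z) *\<^sub>C (b1 * f2) + (l / z) *\<^sub>C (a1 * f2)"
    unfolding 1 2 c
    by (simp add: left_diff_distrib right_diff_distrib scaleC_algebra a b)
  also have "\<dots> = (l * z - l / z) *\<^sub>C (b1 * f2)"
    by (simp add: scaleC_diff_left)
  also have "l * z - l / z = 1"
    using assms(2,3) by (simp add: l_def divide_simps)
  finally show "qcomm q f2 f1 * e1 - e1 * qcomm q f2 f1 = b1 * f2"
    by (simp add: scaleC_one)
  have "qcomm q f1 f2 * e1 - e1 * qcomm q f1 f2
     = (f1 * f2 * e1 - e1 * f1 * f2) - (1 / z) *\<^sub>C (f2 * f1 * e1 - e1 * f2 * f1)"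
    by (simp add: qcomm_def z_def left_diff_distrib right_diff_distrib scaleC_algebra mult.assoc)
  also have "\<dots> = (l / z / z) *\<^sub>C (a1 * f2) - l *\<^sub>C (a1 * f2)"
    unfolding 1 2 c using assms(2)
    by (simp add: left_diff_distrib right_diff_distrib scaleC_algebra a b)
  also have "\<dots> = (l / z / z - l) *\<^sub>C (a1 * f2)"
    by (simp add: scaleC_diff_left)
  also have "l / z / z - l = - (1 / z)"
    using assms(2,3) by (simp add: l_def divide_simps)
  finally show "qcomm q f1 f2 * e1 - e1 * qcomm q f1 f2 = (- (1 / z)) *\<^sub>C (a1 * f2)" .
qed

text \<open>The commutator with \<open>e1\<close> is computed summand by summand. The last
  assumptions are two forms of the relation for the cube of \<open>H\<close>; they convert the
  Cartan products arising from \<open>e1\<close> and \<open>f1\<close> into the squares of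
  \<open>h\<close> and \<open>h'\<close>.\<close>

lemma cas_commute_raising:
  fixes q :: real and h :: "'u::complex_alg_1"
  defines "z \<equiv> complex_of_real q"
  assumes z: "z \<noteq> 0" "z - 1 / z \<noteq> 0"
    and ef: "e1 * f1 - f1 * e1 = (1 / (z - 1 / z)) *\<^sub>C (a1 - b1)" "e1 * f2 = f2 * e1"
    and serre: "e1 ^ 2 * e2 - (z + 1 / z) *\<^sub>C (e1 * e2 * e1) + e2 * e1 ^ 2 = 0"
    and f2: "qcommute z a1 f2" "qcommute (1 / z) b1 f2"
    and e1: "qcommute (1 / z) e1 h" "qcommute z e1 h'"
      "qcommute (1 / z ^ 2) e1 a1" "qcommute (z ^ 2) e1 b1"
      "qcommute z e1 a2" "qcommute (1 / z) e1 b2"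
    and comm: "a1 * a2 = a2 * a1" "b1 * b2 = b2 * b1"
    and h: "h * a2 * b1 = h' ^ 2" "h' * b2 * a1 = h ^ 2"
  shows "e1 * cas q h h' a1 b1 e1 f1 a2 b2 e2 f2 = cas q h h' a1 b1 e1 f1 a2 b2 e2 f2 * e1"
proof -
  define l where "l = 1 / (z - 1 / z)"
  define D where "D x = x * e1 - e1 * x" for x
  have D_add: "D (x + y) = D x + D y" and D_diff: "D (x - y) = D x - D y"
    and D_scale: "D (c *\<^sub>C x) = c *\<^sub>C D x" for x y c
    by (simp_all add: D_def algebra_simps scaleC_algebra)
  have D_q: "D x = (1 - c) *\<^sub>C (x * e1)" if "qcommute c e1 x" for c x
    unfolding D_def by (rule qcommute_commutator[OF that])

  have t0: "D ((l ^ 2) *\<^sub>C ((h + h') * ((z ^ 2) *\<^sub>C (a1 * a2) + (1 / z ^ 2) *\<^sub>C (b1 * b2))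
         + h ^ 2 + h' ^ 2 - 6))
     = (l * z) *\<^sub>C (h * a1 * a2 * e1) - (l / z) *\<^sub>C (h' * b1 * b2 * e1)
       + (l / z) *\<^sub>C (h ^ 2 * e1) - (l * z) *\<^sub>C (h' ^ 2 * e1)"
  proof -
    note m = qcommute_mult_right
    \<comment> \<open>The scalar of a Cartan monomial against \<open>e1\<close> is the product of
      the scalars of its factors. It is \<open>1\<close> for \<open>h' * (a1 * a2)\<close> and
      \<open>h * (b1 * b2)\<close>, which therefore drop out.\<close>
    have 1: "D (h * (a1 * a2)) = (1 - 1 / z ^ 2) *\<^sub>C (h * (a1 * a2) * e1)"
      using D_q[OF m[OF e1(1) m[OF e1(3,5)]]] z by (simp add: power2_eq_square)
    have 2: "D (h' * (a1 * a2)) = 0"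
      using D_q[OF m[OF e1(2) m[OF e1(3,5)]]] z by (simp add: power2_eq_square)
    have 3: "D (h * (b1 * b2)) = 0"
      using D_q[OF m[OF e1(1) m[OF e1(4,6)]]] z by (simp add: power2_eq_square)
    have 4: "D (h' * (b1 * b2)) = (1 - z ^ 2) *\<^sub>C (h' * (b1 * b2) * e1)"
      using D_q[OF m[OF e1(2) m[OF e1(4,6)]]] z by (simp add: power2_eq_square)
    have 5: "D (h ^ 2) = (1 - 1 / z ^ 2) *\<^sub>C (h ^ 2 * e1)"
      using D_q[OF m[OF e1(1,1)]] by (simp add: power2_eq_square)
    have 6: "D (h' ^ 2) = (1 - z ^ 2) *\<^sub>C (h' ^ 2 * e1)"
      using D_q[OF m[OF e1(2,2)]] by (simp add: power2_eq_square)
    have 7: "D 6 = 0"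
      by (simp add: D_def mult_of_nat_commute[of 6, simplified])
    \<comment> \<open>One factor \<open>l\<close> is absorbed because
      \<open>1 - 1 / z ^ 2 = 1 / (l * z)\<close> and \<open>1 - z ^ 2 = - (z / l)\<close>.\<close>
    have c: "l ^ 2 * (z ^ 2 * (1 - 1 / z ^ 2)) = l * z" "l ^ 2 * (1 / z ^ 2 * (1 - z ^ 2)) = - (l / z)"
      "l ^ 2 * (1 - 1 / z ^ 2) = l / z" "l ^ 2 * (1 - z ^ 2) = - (l * z)"
      using z by (simp_all add: l_def power2_eq_square divide_simps, algebra+)
    have "D ((l ^ 2) *\<^sub>C ((h + h') * ((z ^ 2) *\<^sub>C (a1 * a2) + (1 / z ^ 2) *\<^sub>C (b1 * b2))
         + h ^ 2 + h' ^ 2 - 6))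
       = (l ^ 2 * (z ^ 2 * (1 - 1 / z ^ 2))) *\<^sub>C (h * (a1 * a2) * e1)
         + (l ^ 2 * (1 / z ^ 2 * (1 - z ^ 2))) *\<^sub>C (h' * (b1 * b2) * e1)
         + (l ^ 2 * (1 - 1 / z ^ 2)) *\<^sub>C (h ^ 2 * e1) + (l ^ 2 * (1 - z ^ 2)) *\<^sub>C (h' ^ 2 * e1)"
      by (simp only: distrib_left distrib_right mult_scaleC_right D_add D_diff D_scale 1 2 3 4 5 6 7
          scaleC_add_right scaleC_scaleC scaleC_zero_right add_0_right add_0_left diff_0_right ac_simps)
    then show ?thesis
      unfolding c by (simp add: scaleC_minus_left mult.assoc)
  qed

  have t1: "D ((z *\<^sub>C (h * a2) + (1 / z) *\<^sub>C (h' * b2)) * f1 * e1)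
     = - ((l * z) *\<^sub>C (h * a1 * a2 * e1)) + (l / z) *\<^sub>C (h' * b1 * b2 * e1)
       - (l / z) *\<^sub>C (h ^ 2 * e1) + (l * z) *\<^sub>C (h' ^ 2 * e1)"
  proof -
    define x where "x = z *\<^sub>C (h * a2) + (1 / z) *\<^sub>C (h' * b2)"
    \<comment> \<open>In \<open>h * a2\<close> and in \<open>h' * b2\<close> the scalars
      \<open>z\<close> and \<open>1 / z\<close> cancel, so only \<open>f1\<close> fails to commute
      with \<open>e1\<close>.\<close>
    have "qcommute 1 e1 x"
      unfolding x_def
      using qcommute_mult_right[OF e1(1,5)] qcommute_mult_right[OF e1(2,6)] z
      by (intro qcommute_add qcommute_scaleC) simp_all
    then have x: "e1 * x = x * e1" by (simp add: qcommute_one_iff)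
    have "D (x * f1 * e1) = - (x * (e1 * f1 - f1 * e1) * e1)"
      unfolding D_def using x by (simp add: algebra_simps) (metis mult.assoc)
    also have "\<dots> = - (l *\<^sub>C (x * (a1 - b1) * e1))"
      unfolding ef(1) by (simp add: mult_scaleC_left mult_scaleC_right l_def)
    also have "x * (a1 - b1) = z *\<^sub>C (h * a1 * a2) - z *\<^sub>C h' ^ 2 + (1 / z) *\<^sub>C h ^ 2 - (1 / z) *\<^sub>C (h' * b1 * b2)"
      unfolding x_def h[symmetric]
      by (simp add: algebra_simps scaleC_algebra comm)
    finally show ?thesis
      unfolding x_def[symmetric] by (simp add: algebra_simps scaleC_algebra)
  qed

  have t2: "D ((z *\<^sub>C (h' * a1) + (1 / z) *\<^sub>C (h * b1)) * f2 * e2)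
     = z *\<^sub>C (h' * a1 * f2 * qcomm q e2 e1) - h * b1 * f2 * qcomm q e1 e2"
  proof -
    \<comment> \<open>The scalar picked up by passing the Cartan factor is the one that turns the
      difference of \<open>e2 * e1\<close> and \<open>e1 * e2\<close> into a q-commutator.\<close>
    have 1: "e1 * (h' * a1) = (1 / z) *\<^sub>C (h' * a1 * e1)"
      using qcommute_mult_right[OF e1(2,3)] z by (simp add: qcommute_def power2_eq_square)
    have 2: "e1 * (h * b1) = z *\<^sub>C (h * b1 * e1)"
      using qcommute_mult_right[OF e1(1,4)] z by (simp add: qcommute_def power2_eq_square)
    have 3: "e1 * (h' * a1) * f2 * e2 = (1 / z) *\<^sub>C (h' * a1 * f2 * e1 * e2)"
      unfolding 1 using ef(2) by (simp add: scaleC_algebra mult.assoc)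
    have 4: "e1 * (h * b1) * f2 * e2 = z *\<^sub>C (h * b1 * f2 * e1 * e2)"
      unfolding 2 using ef(2) by (simp add: scaleC_algebra mult.assoc)
    have 5: "D (h' * a1 * f2 * e2) = h' * a1 * f2 * qcomm q e2 e1"
      using 3 by (simp add: D_def qcomm_def z_def right_diff_distrib scaleC_algebra mult.assoc)
    have 6: "D (h * b1 * f2 * e2) = (- z) *\<^sub>C (h * b1 * f2 * qcomm q e1 e2)"
      using 4 z by (simp add: D_def qcomm_def z_def right_diff_distrib scaleC_algebra mult.assoc
          scaleC_minus_left)
    show ?thesis
      using z by (simp add: distrib_right D_add D_scale 5 6 scaleC_algebra mult_scaleC_left scaleC_minus_left scaleC_minus_right)
  qed

  \<comment> \<open>Passing \<open>e1\<close> through \<open>y\<close> from the right and through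
    \<open>k\<close> from the left gives the same factor \<open>1 / d\<close>, which leaves the
    plain commutator of \<open>x\<close>.\<close>
  have t34: "D (c *\<^sub>C (k * x * y)) = (c / d) *\<^sub>C (k * (x * e1 - e1 * x) * y)"
    if "qcommute d e1 y" "qcommute (1 / d) e1 k" "d \<noteq> 0" for c d k x y
  proof -
    have 1: "y * e1 = (1 / d) *\<^sub>C (e1 * y)"
      using qcommute_sym[OF that(1,3)] by (simp add: qcommute_def)
    have "k * x * y * e1 = (1 / d) *\<^sub>C (k * x * e1 * y)"
      by (simp add: mult.assoc 1 scaleC_algebra)
    moreover have "e1 * (k * x * y) = (1 / d) *\<^sub>C (k * e1 * x * y)"
      using that(2) by (simp add: qcommute_def scaleC_algebra flip: mult.assoc)
    ultimately have "D (k * x * y) = (1 / d) *\<^sub>C (k * (x * e1 - e1 * x) * y)"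
      by (simp add: D_def algebra_simps scaleC_algebra)
    then show ?thesis by (simp add: D_scale scaleC_scaleC)
  qed
  have s: "qcommute z e1 (qcomm q e1 e2)" "qcommute (1 / z) e1 (qcomm q e2 e1)"
    using qcommute_serre[of q e1 e2] z serre by (simp_all add: z_def)
  note X = commutator_qcomm[of q, folded z_def, OF z ef f2]
  have t3: "D (z *\<^sub>C (h * qcomm q f2 f1 * qcomm q e1 e2)) = h * b1 * f2 * qcomm q e1 e2"
    using t34[OF s(1) e1(1) z(1)] z(1) by (simp add: X scaleC_one mult.assoc)
  have t4: "D (z *\<^sub>C (h' * qcomm q f1 f2 * qcomm q e2 e1)) = - (z *\<^sub>C (h' * a1 * f2 * qcomm q e2 e1))"
    using t34[OF s(2), of h'] e1(2) z(1)
    by (simp add: X scaleC_algebra scaleC_minus_left scaleC_minus_right mult.assoc)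

  \<comment> \<open>\<open>t0\<close> cancels against \<open>t1\<close>, and the two terms of \<open>t2\<close> against \<open>t4\<close> and \<open>t3\<close>.\<close>
  have "D (cas q h h' a1 b1 e1 f1 a2 b2 e2 f2) = 0"
    unfolding cas_def z_def[symmetric] D_add
    using t0 by (simp add: t1 t2 t3 t4 l_def power_divide D_add D_diff)
  then show ?thesis by (simp add: D_def)
qed


section \<open>Centrality in the quantum enveloping algebra\<close>

lemma uq_relations_eqs:
  fixes g :: "ugen \<Rightarrow> 'u::complex_alg_1"
  assumes "presented_by g (uq_relations q)"
  defines "z \<equiv> complex_of_real q"
  shows "g (K i) * g (Ki i) = 1" and "g (Ki i) * g (K i) = 1"
    and "g (K N1) * g (K N2) = g (K N2) * g (K N1)"
    and "g (K i) * g (E i) * g (Ki i) = z *\<^sub>C g (E i)"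
    and "g (K i) * g (F i) * g (Ki i) = (1 / z) *\<^sub>C g (F i)"
    and "g (E i) * g (F i) - g (F i) * g (E i) = (1 / (z - 1 / z)) *\<^sub>C (g (K i) ^ 2 - g (Ki i) ^ 2)"
    and "i \<noteq> j \<Longrightarrow> g (K i) * g (E j) * g (Ki i) = complex_of_real (q powr (- 1/2)) *\<^sub>C g (E j)"
    and "i \<noteq> j \<Longrightarrow> g (K i) * g (F j) * g (Ki i) = complex_of_real (q powr (1/2)) *\<^sub>C g (F j)"
    and "i \<noteq> j \<Longrightarrow> g (E i) * g (F j) = g (F j) * g (E i)"
    and "i \<noteq> j \<Longrightarrow> g (E i) ^ 2 * g (E j) - (z + 1 / z) *\<^sub>C (g (E i) * g (E j) * g (E i))
      + g (E j) * g (E i) ^ 2 = 0"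
    and "g H * g Hi = 1" and "g Hi * g H = 1" and "g H * g (K i) = g (K i) * g H"
    and "g H * g (E N1) * g Hi = z *\<^sub>C g (E N1)" and "g H * g (E N2) * g Hi = (1 / z) *\<^sub>C g (E N2)"
    and "g H * g (F N1) * g Hi = (1 / z) *\<^sub>C g (F N1)" and "g H * g (F N2) * g Hi = z *\<^sub>C g (F N2)"
    and "g H ^ 3 = (g (K N1) * g (Ki N2)) ^ 2"
proof -
  note rel = presented_by_relation[OF assms(1), unfolded uq_relations_def]
  note ev = evaluate_hom mult_scaleC_left z_def
  show "g (K i) * g (Ki i) = 1"
    using rel[of "gen (K i) * gen (Ki i) - 1"] by (force simp: ev)
  show "g (Ki i) * g (K i) = 1"
    using rel[of "gen (Ki i) * gen (K i) - 1"] by (force simp: ev)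
  show "g (K N1) * g (K N2) = g (K N2) * g (K N1)"
    using rel[of "gen (K N1) * gen (K N2) - gen (K N2) * gen (K N1)"] by (simp add: ev)
  show "g (K i) * g (E i) * g (Ki i) = z *\<^sub>C g (E i)"
    using rel[of "gen (K i) * gen (E i) * gen (Ki i) - cst q * gen (E i)"] by (force simp: ev)
  show "g (K i) * g (F i) * g (Ki i) = (1 / z) *\<^sub>C g (F i)"
    using rel[of "gen (K i) * gen (F i) * gen (Ki i) - cst (1 / q) * gen (F i)"] by (force simp: ev)
  show "g (E i) * g (F i) - g (F i) * g (E i) = (1 / (z - 1 / z)) *\<^sub>C (g (K i) ^ 2 - g (Ki i) ^ 2)"
    using rel[of "gen (E i) * gen (F i) - gen (F i) * gen (E i)
        - cst (1 / (q - 1 / q)) * (gen (K i) ^ 2 - gen (Ki i) ^ 2)"] by (force simp: ev)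
  show "g H * g Hi = 1" "g Hi * g H = 1"
    using rel[of "gen H * gen Hi - 1"] rel[of "gen Hi * gen H - 1"] by (simp_all add: ev)
  show "g H * g (K i) = g (K i) * g H"
    using rel[of "gen H * gen (K i) - gen (K i) * gen H"] by (force simp: ev)
  show "g H * g (E N1) * g Hi = z *\<^sub>C g (E N1)"
    using rel[of "gen H * gen (E N1) * gen Hi - cst q * gen (E N1)"] by (simp add: ev)
  show "g H * g (E N2) * g Hi = (1 / z) *\<^sub>C g (E N2)"
    using rel[of "gen H * gen (E N2) * gen Hi - cst (1 / q) * gen (E N2)"] by (simp add: ev)
  show "g H * g (F N1) * g Hi = (1 / z) *\<^sub>C g (F N1)"
    using rel[of "gen H * gen (F N1) * gen Hi - cst (1 / q) * gen (F N1)"] by (simp add: ev)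
  show "g H * g (F N2) * g Hi = z *\<^sub>C g (F N2)"
    using rel[of "gen H * gen (F N2) * gen Hi - cst q * gen (F N2)"] by (simp add: ev)
  show "g H ^ 3 = (g (K N1) * g (Ki N2)) ^ 2"
    using rel[of "gen H ^ 3 - (gen (K N1) * gen (Ki N2)) ^ 2"] by (simp add: ev)
  assume ij: "i \<noteq> j"
  show "g (K i) * g (E j) * g (Ki i) = complex_of_real (q powr (- 1/2)) *\<^sub>C g (E j)"
    using ij rel[of "gen (K i) * gen (E j) * gen (Ki i) - cst (q powr (- 1/2)) * gen (E j)"]
    by (force simp: ev)
  show "g (K i) * g (F j) * g (Ki i) = complex_of_real (q powr (1/2)) *\<^sub>C g (F j)"
    using ij rel[of "gen (K i) * gen (F j) * gen (Ki i) - cst (q powr (1/2)) * gen (F j)"]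
    by (force simp: ev)
  show "g (E i) * g (F j) = g (F j) * g (E i)"
    using ij rel[of "gen (E i) * gen (F j) - gen (F j) * gen (E i)"] by (force simp: ev)
  show "g (E i) ^ 2 * g (E j) - (z + 1 / z) *\<^sub>C (g (E i) * g (E j) * g (E i))
      + g (E j) * g (E i) ^ 2 = 0"
    using ij rel[of "gen (E i) ^ 2 * gen (E j) - cst (q + 1 / q) * gen (E i) * gen (E j) * gen (E i)
        + gen (E j) * gen (E i) ^ 2"] by (force simp: ev)
qed

text \<open>The two claims are proved together: invariance under \<theta> carries commutation with
  \<open>E i\<close> over to \<open>F i\<close>.\<close>

lemma casimir_central_theta:
  fixes g :: "ugen \<Rightarrow> 'u::complex_alg_1"
  assumes q: "0 < q" "q < 1" and pres: "presented_by g (uq_relations q)" and theta: "is_theta g \<theta>"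
  shows "\<theta> (casimir q g) = casimir q g" and "x * casimir q g = casimir q g * x"
proof -
  define z where "z = complex_of_real q"
  have z: "z \<noteq> 0" "z - 1 / z \<noteq> 0"
  proof -
    show "z \<noteq> 0" using q by (simp add: z_def)
    have "q - 1 / q \<noteq> 0"
      using q less_trans[OF q(2), of "1 / q"] by simp
    then have "complex_of_real (q - 1 / q) \<noteq> 0" by (simp only: of_real_eq_0_iff not_False_eq_True)
    then show "z - 1 / z \<noteq> 0" by (simp add: z_def)
  qed
  note R = uq_relations_eqs[OF pres, folded z_def]
  \<comment> \<open>With \<open>H\<close> attached to index 1 and its inverse to index 2, the
    symmetry of the Casimir element is the exchange of \<open>i\<close> and \<open>j\<close> in
    \<open>C i j\<close>.\<close>
  define hh where "hh i = g (case i of N1 \<Rightarrow> H | N2 \<Rightarrow> Hi)" for i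
  define a where "a i = g (K i) ^ 2" for i
  define b where "b i = g (Ki i) ^ 2" for i
  define C where "C i j = cas q (hh i) (hh j) (a i) (b i) (g (E i)) (g (F i)) (a j) (b j) (g (E j)) (g (F j))" for i j

  \<comment> \<open>\<open>K i\<close> has half-integral powers of \<open>q\<close> as scalars on
    the other index; its square \<open>a i\<close> has integral ones.\<close>
  have sq1: "complex_of_real (q powr (- 1/2)) * complex_of_real (q powr (- 1/2)) = 1 / z"
    unfolding of_real_mult[symmetric] powr_add[symmetric] using q by (simp add: z_def powr_minus_divide)
  have sq2: "complex_of_real (q powr (1/2)) * complex_of_real (q powr (1/2)) = z"
    unfolding of_real_mult[symmetric] powr_add[symmetric] using q by (simp add: z_def)
  have p0: "complex_of_real (q powr (- 1/2)) \<noteq> 0" "complex_of_real (q powr (1/2)) \<noteq> 0"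
    using q by simp_all

  have KE: "qcommute z (g (K i)) (g (E i))" and KF: "qcommute (1 / z) (g (K i)) (g (F i))" for i
    using qcommute_conj[OF R(4) R(2)] qcommute_conj[OF R(5) R(2)] by blast+
  have KE': "qcommute (complex_of_real (q powr (- 1/2))) (g (K i)) (g (E j))"
    and KF': "qcommute (complex_of_real (q powr (1/2))) (g (K i)) (g (F j))" if "i \<noteq> j" for i j
    using qcommute_conj[OF R(7) R(2)] qcommute_conj[OF R(8) R(2)] that by blast+
  have HE: "qcommute z (g H) (g (E N1))" "qcommute (1 / z) (g H) (g (E N2))"
    "qcommute (1 / z) (g H) (g (F N1))" "qcommute z (g H) (g (F N2))"
    using qcommute_conj[OF R(14) R(12)] qcommute_conj[OF R(15) R(12)]
      qcommute_conj[OF R(16) R(12)] qcommute_conj[OF R(17) R(12)] by blast+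

  have inv1: "qcommute 1 x' y" if "qcommute 1 x y" "x * x' = 1" "x' * x = 1" for x x' y :: 'u
    using qcommute_inverse[OF that(1) _ that(2,3)] by simp
  have sym1: "qcommute 1 y x" if "qcommute 1 x y" for x y :: 'u
    using qcommute_sym[OF that] by simp
  have refl1: "qcommute 1 x x" for x :: 'u
    by (simp add: qcommute_one_iff)
  let ?T = "insert (g H) (insert (g Hi) (range (\<lambda>i. g (K i)) \<union> range (\<lambda>i. g (Ki i))))"
  have KK: "qcommute 1 (g (K i)) (g (K j))" for i j
    using R(3) by (cases i; cases j) (simp_all add: qcommute_one_iff)
  have HK: "qcommute 1 (g H) (g (K i))" for i
    using R(13) by (simp add: qcommute_one_iff)
  have Ti: "qcommute 1 x (g Hi)" if "qcommute 1 x (g H)" for x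
    by (rule sym1, rule inv1[OF sym1[OF that] R(11,12)])
  have TKi: "qcommute 1 x (g (Ki i))" if "qcommute 1 x (g (K i))" for x i
    by (rule sym1, rule inv1[OF sym1[OF that] R(1,2)])
  have T: "qcommute 1 s t" if "s \<in> ?T" "t \<in> ?T" for s t
    using that KK HK sym1[OF HK] TKi[OF sym1[OF Ti[OF sym1[OF HK]]]] sym1[OF TKi[OF sym1[OF Ti[OF sym1[OF HK]]]]]
    by (auto intro: refl1 Ti TKi Ti[THEN sym1] TKi[THEN sym1])
  then have Tc: "s * t = t * s" if "s \<in> ?T" "t \<in> ?T" for s t
    using that by (simp add: qcommute_one_iff)

  let ?W = "weight_element (g (E N1)) (g (F N1)) (g (E N2)) (g (F N2))"
  have WH: "?W (g H)"
    unfolding weight_element_def using HE z by (intro exI[of _ z] exI[of _ "1 / z"]) simp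
  have WK: "?W (g (K i))" for i
  proof -
    have p: "1 / complex_of_real (q powr (- 1/2)) = complex_of_real (q powr (1/2))"
      by (simp add: powr_minus_divide)
    show ?thesis
    proof (cases i)
      case N1
      then show ?thesis
        unfolding weight_element_def using KE[of N1] KF[of N1] KE'[of N1 N2] KF'[of N1 N2] z p0 p
        by (intro exI[of _ z] exI[of _ "complex_of_real (q powr (- 1/2))"]) simp
    next
      case N2
      then show ?thesis
        unfolding weight_element_def using KE[of N2] KF[of N2] KE'[of N2 N1] KF'[of N2 N1] z p0 p
        by (intro exI[of _ "complex_of_real (q powr (- 1/2))"] exI[of _ z]) simp
    qed
  qed
  have W: "?W t" if "t \<in> ?T" for t
    using that WH WK weight_element_inverse[OF WH R(11,12)] weight_element_inverse[OF WK R(1,2)] by auto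

  have cas: "casimir q g = C N1 N2"
  proof -
    \<comment> \<open>\<open>casimir\<close> squares the product of the \<open>K i\<close>, while
      \<open>cas\<close> multiplies their squares; commutativity identifies the two.\<close>
    have K: "g (K N1) * g (K N2) = g (K N2) * g (K N1)" "g (Ki N1) * g (Ki N2) = g (Ki N2) * g (Ki N1)"
      "g (K N1) * (g (K N2) * x) = g (K N2) * (g (K N1) * x)"
      "g (Ki N1) * (g (Ki N2) * x) = g (Ki N2) * (g (Ki N1) * x)" for x
      using Tc[of "g (K N1)" "g (K N2)"] Tc[of "g (Ki N1)" "g (Ki N2)"] by (simp_all flip: mult.assoc)
    show ?thesis
      unfolding casimir_def C_def cas_def hh_def a_def b_def
      by (simp add: power2_eq_square scaleC_algebra mult.assoc K)
  qed

  have cartan_comm: "s * t = t * s"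
    if "s \<in> {hh i, hh j, a i, b i, a j, b j}" "t \<in> ?T \<union> {hh i, hh j, a i, b i, a j, b j}" for s t i j
  proof -
    have hT: "hh i \<in> ?T" for i by (cases i) (simp_all add: hh_def)
    have 1: "qcommute 1 t s" if "s \<in> {hh i, hh j, a i, b i, a j, b j}" "\<And>u. u \<in> ?T \<Longrightarrow> qcommute 1 t u" for s t
      using that qcommute_mult_right[where c = 1 and d = 1] hT
      by (auto simp: a_def b_def power2_eq_square)
    have 2: "qcommute 1 s t" if "s \<in> {hh i, hh j, a i, b i, a j, b j}" "t \<in> ?T" for s t
      using 1[OF that(1) T[OF that(2)]] by (rule sym1)
    have "qcommute 1 s t"
      using that(2)
    proof
      assume "t \<in> {hh i, hh j, a i, b i, a j, b j}"
      then show ?thesis using 1 2[OF that(1)] by blast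
    qed (rule 2[OF that(1)])
    then show ?thesis by (simp add: qcommute_one_iff)
  qed

  have Ct: "t * casimir q g = casimir q g * t" if "t \<in> ?T" for t
    unfolding cas C_def
    by (rule cas_commute_weight[OF W[OF that]]) (use cartan_comm[of _ N1 N2] that in \<open>metis UnI1\<close>)

  have hE: "qcommute z (hh i) (g (E i))" for i
    using HE qcommute_inverse[OF HE(2) _ R(11,12)] z by (cases i) (simp_all add: hh_def)
  have hE': "qcommute (1 / z) (hh i) (g (E j))" if "i \<noteq> j" for i j
    using that HE qcommute_inverse[OF HE(1) _ R(11,12)] z by (cases i; cases j) (simp_all add: hh_def)
  have inv2: "b i * a i = 1" "a i * b i = 1" for i
    using R(1,2)[of i] by (simp_all add: a_def b_def power2_eq_square) (metis mult.assoc mult_1)+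
  have aE: "qcommute (z ^ 2) (a i) (g (E i))" for i
    using qcommute_mult_left[OF KE KE] by (simp add: a_def power2_eq_square)
  have aE': "qcommute (1 / z) (a i) (g (E j))" if "i \<noteq> j" for i j
    using qcommute_mult_left[OF KE'[OF that] KE'[OF that]] sq1 by (simp add: a_def power2_eq_square)
  have aF': "qcommute z (a i) (g (F j))" if "i \<noteq> j" for i j
    using qcommute_mult_left[OF KF'[OF that] KF'[OF that]] sq2 by (simp add: a_def power2_eq_square)
  have bE: "qcommute (1 / z ^ 2) (b i) (g (E i))" for i
    using qcommute_inverse[OF aE _ inv2(2,1)] z by simp
  have bE': "qcommute z (b i) (g (E j))" if "i \<noteq> j" for i j
    using qcommute_inverse[OF aE'[OF that] _ inv2(2,1)] z by simp
  have bF': "qcommute (1 / z) (b i) (g (F j))" if "i \<noteq> j" for i j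
    using qcommute_inverse[OF aF'[OF that] _ inv2(2,1)] z by simp

  have hab: "hh i * a j * b i = hh j ^ 2" if "i \<noteq> j" for i j
  proof -
    have cc: "s * t = t * s" if "s \<in> {hh i, hh j, a i, b i, a j, b j}" "t \<in> {hh i, hh j, a i, b i, a j, b j}" for s t i j
      using cartan_comm[OF that(1)] that(2) by blast
    \<comment> \<open>With the cube of \<open>H\<close> equal to \<open>a N1 * b N2\<close>, whose
      inverse is \<open>b N1 * a N2\<close>, the two cases amount to \<open>H^-1 H^3 = H^2\<close>
      and \<open>H H^-3 = H^-2\<close>.\<close>
    have h3: "g H ^ 3 = a N1 * b N2"
    proof -
      have "g (Ki N2) * (g (K N1) * x) = g (K N1) * (g (Ki N2) * x)" for x
        using Tc[of "g (Ki N2)" "g (K N1)"] by (simp flip: mult.assoc)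
      then show ?thesis
        unfolding R(18) a_def b_def by (simp add: power2_eq_square mult.assoc)
    qed
    have "hh N2 * b N2 * a N1 = hh N2 * g H ^ 3"
      unfolding h3 using cc[of "a N1" N1 N2 "b N2"] by (simp add: mult.assoc)
    also have "\<dots> = g Hi * g H * g H ^ 2"
      by (simp add: hh_def mult.assoc power_numeral_reduce power2_eq_square)
    finally have 1: "hh N2 * b N2 * a N1 = hh N1 ^ 2"
      by (simp add: R(12) hh_def)
    have "(a N1 * b N2) * (b N1 * a N2) = 1"
    proof -
      have "(a N1 * b N2) * (b N1 * a N2) = a N1 * (b N2 * a N2) * b N1"
        using cc[of "b N1" N1 N2 "a N2"] by (simp add: mult.assoc)
      then show ?thesis by (simp add: inv2)
    qed
    then have "g Hi ^ 2 * (g H ^ 3 * (b N1 * a N2)) = g Hi ^ 2"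
      unfolding h3 by simp
    moreover have "g Hi ^ 2 * (g H ^ 3 * x) = g H * x" for x
    proof -
      have "g Hi * (g H * y) = y" for y using R(12) by (simp flip: mult.assoc)
      then show ?thesis by (simp add: power_numeral_reduce mult.assoc)
    qed
    ultimately have 2: "hh N1 * b N1 * a N2 = hh N2 ^ 2"
      by (simp add: hh_def mult.assoc)
    show ?thesis
      using that 1 2 cc[of "a j" i j "b i"] by (cases i; cases j) (simp_all add: mult.assoc)
  qed
  have hba: "hh j * b j * a i = hh i ^ 2" if "i \<noteq> j" for i j
    using hab[of j i] that cartan_comm[of "a i" i j "b j"] by (simp add: mult.assoc)

  \<comment> \<open>The weights are known with the Cartan element on the left;
    \<open>qcommute_sym\<close> puts \<open>E i\<close> there, inverting the scalars.\<close>
  have CE: "g (E i) * C i j = C i j * g (E i)" if "i \<noteq> j" for i j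
    unfolding C_def
    by (rule cas_commute_raising)
      (use that z R(6)[of i] R(9,10)[OF that] hab[OF that] hba[OF that]
        aF'[OF that] bF'[OF that] qcommute_sym[OF hE[of i]] qcommute_sym[OF hE'[of j i]]
        qcommute_sym[OF aE[of i]] qcommute_sym[OF bE[of i]] qcommute_sym[OF aE'[of j i]]
        qcommute_sym[OF bE'[of j i]] cartan_comm[of "a i" i j "a j"] cartan_comm[of "b i" i j "b j"]
        in \<open>simp_all add: z_def a_def b_def\<close>)
  \<comment> \<open>By this symmetry the case \<open>i = N2\<close> of \<open>CE\<close> also
    concerns the Casimir element.\<close>
  have "C N1 N2 = C N2 N1"
    unfolding C_def
    by (rule cas_swap) (use cartan_comm[of "a N1" N1 N2 "a N2"] cartan_comm[of "b N1" N1 N2 "b N2"] in auto)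
  then have CE: "g (E i) * casimir q g = casimir q g * g (E i)" for i
    using CE[of N1 N2] CE[of N2 N1] cas by (cases i) simp_all

  have lin: "clinear \<theta>" and anti: "\<theta> (x * y) = \<theta> y * \<theta> x"
    and tg: "\<theta> (g (K i)) = g (K i)" "\<theta> (g H) = g H" "\<theta> (g (E i)) = g (F i)" "\<theta> (g (F i)) = g (E i)"
    for x y i
    using theta by (simp_all add: is_theta_def)
  \<comment> \<open>Applying \<theta> to \<open>H * 1\<close> gives
    \<open>H = \<theta> 1 * H\<close>, and \<open>H\<close> is invertible.\<close>
  have one: "\<theta> 1 = 1"
    using anti[of "g H" 1] tg(2) R(11) by (metis mult.assoc mult_1_right)
  \<comment> \<open>\<theta> maps an inverse of \<open>x\<close> to an inverse of
    \<theta>\<open>x = x\<close>, and inverses are unique.\<close>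
  have inv: "\<theta> x' = x'" if "x * x' = 1" "x' * x = 1" "\<theta> x = x" for x x'
    using anti[of x x'] that one by (metis mult.assoc mult_1 mult_1_right)
  note tg' = inv[OF R(11,12) tg(2)] inv[OF R(1,2) tg(1)]
  show tC: "\<theta> (casimir q g) = casimir q g"
    unfolding cas C_def
  proof (rule antihom_cas[OF lin one anti])
    fix t assume t: "t \<in> {hh N1, hh N2, a N1, b N1, a N2, b N2}"
    then show "\<theta> t = t"
      by (auto simp: hh_def a_def b_def power2_eq_square anti tg tg')
    show "?W t"
      using t W by (auto simp: hh_def a_def b_def power2_eq_square intro!: weight_element_mult)
    show "s * t = t * s" if "s \<in> {hh N1, hh N2, a N1, b N1, a N2, b N2}" for s
      using cartan_comm[OF that] t by blast
  qed (simp_all add: tg)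
  have CF: "g (F i) * casimir q g = casimir q g * g (F i)" for i
    using arg_cong[OF CE[of i], of \<theta>] by (simp add: anti tC tg)

  have "casimir q g * g w = g w * casimir q g" for w
    by (cases w) (simp_all add: CE CF Ct)
  then show "x * casimir q g = casimir q g * x"
    using presented_by_central[OF pres] by metis
qed


section \<open>Actions and the pairing\<close>

lemma cbilinear_scaled_right:
  "cbilinear p \<Longrightarrow> cbilinear (\<lambda>x y. p h y *\<^sub>C x)"
  by (simp add: cbilinear_def clinear_def scaleC_algebra scaleC_add_left mult.commute scaleC_complex_def)

lemma cbilinear_scaled_left:
  "cbilinear p \<Longrightarrow> cbilinear (\<lambda>x y. p h x *\<^sub>C y)"
  by (simp add: cbilinear_def clinear_def scaleC_algebra scaleC_add_left mult.commute scaleC_complex_def)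

lemma cbilinear_product:
  fixes p :: "'a::complex_vec \<Rightarrow> 'b::complex_vec \<Rightarrow> complex"
  shows "cbilinear p \<Longrightarrow> cbilinear (\<lambda>x y. p h x * p k y)"
  by (simp add: cbilinear_def clinear_def scaleC_complex_def algebra_simps)

text \<open>Allows a linear map to be applied inside a Sweedler sum: both sides are linear in
  \<open>t\<close> and agree on elementary tensors.\<close>

lemma clinear_tensor_lift_comp:
  assumes "clinear f" and "cbilinear B" and "cbilinear B'" and "\<And>x y. f (B x y) = B' x y"
  shows "f (tensor_lift B t) = tensor_lift B' t"
  using assms(1) clinear_tensor_lift[OF assms(2)] clinear_tensor_lift[OF assms(3)]
  by (induction t rule: tensor_induct)
    (simp_all add: tensor_lift_tens assms(2-) clinear_def)

text \<open>Both sides are the Sweedler sum of \<open>p h x * p k y\<close> over the coproduct of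
  \<open>a\<close>: the left action pairs the second leg with \<open>k\<close>, leaving the first
  for \<open>h\<close>.\<close>

lemma pairing_left_action:
  assumes "dual_pairing U A p"
  shows "p h (left_action A p k a) = p (h * k) a"
proof -
  have p: "cbilinear p" and m: "p (h * k) a = tensor_lift (\<lambda>x y. p h x * p k y) (comult A a)"
    using assms by (simp_all add: dual_pairing_def)
  show ?thesis
    unfolding left_action_def m
    by (rule clinear_tensor_lift_comp)
      (use p cbilinear_scaled_right[OF p] cbilinear_product[OF p]
        in \<open>simp_all add: cbilinear_def clinear_def scaleC_complex_def mult.commute\<close>)
qed

text \<open>Here \<open>k\<close> is paired with the first leg and \<open>h\<close> with the second,
  hence the reversed order \<open>k * h\<close>.\<close>

lemma pairing_right_action:
  assumes "dual_pairing U A p"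
  shows "p h (right_action A p a k) = p (k * h) a"
proof -
  have p: "cbilinear p" and m: "p (k * h) a = tensor_lift (\<lambda>x y. p k x * p h y) (comult A a)"
    using assms by (simp_all add: dual_pairing_def)
  show ?thesis
    unfolding right_action_def m
    by (rule clinear_tensor_lift_comp)
      (use p cbilinear_scaled_left[OF p] cbilinear_product[OF p]
        in \<open>simp_all add: cbilinear_def clinear_def scaleC_complex_def\<close>)
qed

theorem lemma3p1:
  fixes q :: real
    and U :: "('u::complex_alg_1) hopf_star" and g :: "ugen \<Rightarrow> 'u"
    and A :: "('a::complex_alg_1) hopf_star" and u :: "ix3 \<Rightarrow> ix3 \<Rightarrow> 'a"
    and \<sigma> :: "'u \<Rightarrow> complex ^ ix3 ^ ix3" and \<theta> :: "'u \<Rightarrow> 'u"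
    and pairing :: "'u \<Rightarrow> 'a \<Rightarrow> complex"
  assumes "0 < q" and "q < 1"
    and "is_uq_su3 q U g" and "is_suq3 q A u"
    and "is_fundamental_rep q U g \<sigma>" and "is_theta g \<theta>"
    and "dual_pairing U A pairing" and "nondegenerate pairing"
    and "\<forall>h i j. pairing h (u i j) = \<sigma> h $ i $ j"
  shows "\<forall>a. left_action A pairing (casimir q g) a = left_action2 A pairing \<theta> (casimir q g) a"
proof
  fix a
  let ?C = "casimir q g"
  have "presented_by g (uq_relations q)"
    using assms(3) by (simp add: is_uq_su3_def)
  note C = casimir_central_theta[OF assms(1,2) this assms(6)]
  have lin: "clinear (pairing h)" for h
    using assms(7) by (simp add: dual_pairing_def cbilinear_def)
  have "pairing h (left_action A pairing ?C a - left_action2 A pairing \<theta> ?C a) = 0" for h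
    by (simp add: clinear_diff[OF lin] left_action2_def pairing_left_action[OF assms(7)]
        pairing_right_action[OF assms(7)] C(1) C(2)[of h])
  then show "left_action A pairing ?C a = left_action2 A pairing \<theta> ?C a"
    using assms(8) unfolding nondegenerate_def by (metis eq_iff_diff_eq_0)
qed

end
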